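(* Let $\alpha_1,\alpha_3,\alpha_4\in\mathbb{F}_{p^m}^*$ be such that $\alpha=\alpha_1+\alpha_3v+\alpha_4uv$ is not a cube in $\mathcal{R}$. Let $\mathcal{C}=\langle(x^3-\alpha_0)^\ell+u(x^3-\alpha_0)^tz(x)\rangle\subseteq\frac{\mathcal{R}[x]}{\langle x^{3p^s}-\alpha\rangle}$ be an $\alpha$-constacyclic code, where $1\le\ell\le2p^s-1$, $0\le t<\ell$, and $z(x)$ is $0$ or invertible. Then the dual code $\mathcal{C}^\perp$, associated to the ideal $\mathcal{A}(\mathcal{C})^*$ of $\frac{\mathcal{R}[x]}{\langle x^{3p^s}-\alpha^{-1}\rangle}$, is determined as follows. 1. If $z(x)=0$ and $1\le\ell\le p^s$, then $\mathcal{A}(\mathcal{C})^*=\langle(x^3-\alpha_0^{-1})^{2p^s-\ell}\rangle$. 2. If $z(x)$ is invertible and $1\le\ell\le p^s+\frac t2$, then $\mathcal{A}(\mathcal{C})^*=\langle\chi_1^*(x)\rangle$, where $$\chi_1^*(x)=(-\alpha_0)^{2p^s-\ell}(x^3-\alpha_0^{-1})^{2p^s-\ell}-u(-\alpha_0)^{2p^s-2\ell+t}(x^3-\alpha_0^{-1})^{2p^s-2\ell+t}\sum_{\kappa=0}^{\ell-t-1}(z_{2\kappa}x^2+z_{1\kappa}x+z_{0\kappa})(-\alpha_0)^\kappa(x^3-\alpha_0^{-1})^\kappa x^{3\ell-3t-3\kappa-2}.$$ 3. If $z(x)$ is invertible and $p^s+\frac t2<\ell\le2p^s-1$, then $\mathcal{A}(\mathcal{C})^*=\langle\chi_2^*(x),\,u(x^3-\alpha_0^{-1})^{2p^s-\ell}\rangle$,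 where $$\chi_2^*(x)=(-\alpha_0)^{\ell-t}(x^3-\alpha_0^{-1})^{\ell-t}-u\sum_{\kappa=0}^{2p^s-\ell-1}(z_{2\kappa}x^2+z_{1\kappa}x+z_{0\kappa})(-\alpha_0)^\kappa(x^3-\alpha_0^{-1})^\kappa x^{3\ell-3t-3\kappa-2}.$$
   Context: $p\neq3$ is a prime, $m,s$ are positive integers, and $\mathcal{R}=\frac{\mathbb{F}_{p^m}[u,v]}{\langle u^2,v^2,uv-vu\rangle}=\mathbb{F}_{p^m}+u\mathbb{F}_{p^m}+v\mathbb{F}_{p^m}+uv\mathbb{F}_{p^m}$ with $u^2=v^2=0$, $uv=vu$. Writing $s=q_0m+r_0$ with $q_0\ge0$ and $0\le r_0\le m-1$, put $\alpha_0=\alpha_1^{p^{m-r_0}}$, so that $\alpha_0^{p^s}=\alpha_1$. When invertible, $z(x)$ is written as a finite sum $z(x)=\sum_{\kappa\ge0}(z_{0\kappa}x^2+z_{1\kappa}x+z_{2\kappa})(x^3-\alpha_0)^\kappa$ with $z_{0\kappa},z_{1\kappa},z_{2\kappa}\in\mathbb{F}_{p^m}$ and $z_{00}x^2+z_{10}x+z_{20}\ne0$ (coefficients not occurring are $0$). Constacyclic codes of length $n=3p^s$ are identified with ideals via $(c_0,\dots,c_{n-1})\mapsto\sum c_ix^i$; $\mathcal{C}^\perp$ is the dual for the standard inner product on $\mathcal{R}^n$. For an ideal $\mathcal{C}$ of $\frac{\mathcal{R}[x]}{\langle x^{3p^s}-\alpha\rangle}$, $\mathcal{A}(\mathcal{C})$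 is its annihilator; the reciprocal of a polynomial $f$ of degree $k$ is $f^*(x)=x^kf(x^{-1})$ ($0^*=0$), and $\mathcal{A}(\mathcal{C})^*=\{f^*(x): f(x)\in\mathcal{R}[x]\text{ represents an element of }\mathcal{A}(\mathcal{C})\}$, viewed in $\frac{\mathcal{R}[x]}{\langle x^{3p^s}-\alpha^{-1}\rangle}$. One has $\mathcal{C}^\perp=\mathcal{A}(\mathcal{C})^*$. *)

theory Defs
  imports
    "HOL-Library.Cardinality"
    "HOL-Computational_Algebra.Polynomial"
    "HOL-Algebra.QuotRing"
begin

section \<open>The ring \<open>F[u,v] / (u^2, v^2, uv - vu)\<close>\<close>

text \<open>\<open>UV a b c d\<close> stands for \<open>a + u b + v c + uv d\<close>.\<close>

datatype 'a uvring = UV 'a 'a 'a 'a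

instantiation uvring :: (comm_ring_1) comm_ring_1
begin

definition zero_uvring :: "'a uvring" where
  "0 = UV 0 0 0 0"

definition one_uvring :: "'a uvring" where
  "1 = UV 1 0 0 0"

fun plus_uvring :: "'a uvring \<Rightarrow> 'a uvring \<Rightarrow> 'a uvring" where
  "UV a b c d + UV a' b' c' d' = UV (a + a') (b + b') (c + c') (d + d')"

fun minus_uvring :: "'a uvring \<Rightarrow> 'a uvring \<Rightarrow> 'a uvring" where
  "UV a b c d - UV a' b' c' d' = UV (a - a') (b - b') (c - c') (d - d')"

fun uminus_uvring :: "'a uvring \<Rightarrow> 'a uvring" where
  "- UV a b c d = UV (- a) (- b) (- c) (- d)"

fun times_uvring :: "'a uvring \<Rightarrow> 'a uvring \<Rightarrow> 'a uvring" where
  "UV a b c d * UV a' b' c' d' =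
     UV (a * a') (a * b' + b * a') (a * c' + c * a') (a * d' + b * c' + c * b' + d * a')"

instance
proof
  fix x y z :: "'a uvring"
  show "x + y + z = x + (y + z)" "x * y * z = x * (y * z)" "(x + y) * z = x * z + y * z"
    by (cases x; cases y; cases z; simp add: algebra_simps)+
  show "x + y = y + x" "x * y = y * x" "x - y = x + - y"
    by (cases x; cases y; simp add: algebra_simps)+
  show "0 + x = x" "1 * x = x" "- x + x = 0"
    by (cases x; simp add: zero_uvring_def one_uvring_def)+
  show "(0 :: 'a uvring) \<noteq> 1"
    by (simp add: zero_uvring_def one_uvring_def)
qed

end

definition emb :: "'a::comm_ring_1 \<Rightarrow> 'a uvring" where
  "emb a = UV a 0 0 0"

definition uu :: "'a::comm_ring_1 uvring" where
  "uu = UV 0 1 0 0"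

definition vv :: "'a::comm_ring_1 uvring" where
  "vv = UV 0 0 1 0"

lemma uu_squared: "uu * uu = 0"
  and vv_squared: "vv * vv = 0"
  and uvring_decomp: "UV a b c d = emb a + uu * emb b + vv * emb c + uu * vv * emb d"
  by (simp_all add: emb_def uu_def vv_def zero_uvring_def)

abbreviation emb_poly :: "'a::comm_ring_1 poly \<Rightarrow> 'a uvring poly" where
  "emb_poly \<equiv> map_poly emb"


section \<open>Constacyclic codes as ideals\<close>

definition type_ring :: "'r::comm_ring_1 ring" where
  "type_ring = \<lparr>carrier = UNIV, mult = (*), one = 1, zero = 0, add = (+)\<rparr>"

lemma cring_type_ring: "cring (type_ring :: 'r::comm_ring_1 ring)"
proof (rule cringI)
  show "abelian_group (type_ring :: 'r ring)"
    by (rule abelian_groupI)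
      (auto simp: type_ring_def algebra_simps intro: exI[of _ "- x" for x] add.left_inverse)
  show "comm_monoid (type_ring :: 'r ring)"
    by (rule comm_monoidI) (simp_all add: type_ring_def algebra_simps)
qed (simp add: type_ring_def algebra_simps)

abbreviation modulus :: "nat \<Rightarrow> 'r::comm_ring_1 \<Rightarrow> 'r poly set" where
  "modulus n a \<equiv> PIdl\<^bsub>type_ring\<^esub> (monom 1 n - [:a:])"

definition consta_ring :: "nat \<Rightarrow> 'r::comm_ring_1 \<Rightarrow> 'r poly set ring" where
  "consta_ring n a = type_ring Quot modulus n a"

lemma cring_consta_ring: "cring (consta_ring n (a :: 'r::comm_ring_1))"
  unfolding consta_ring_def
  by (intro ideal.quotient_is_cring cring.cgenideal_ideal cring_type_ring)
    (simp add: type_ring_def)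

definition residue_class :: "nat \<Rightarrow> 'r::comm_ring_1 \<Rightarrow> 'r poly \<Rightarrow> 'r poly set" where
  "residue_class n a f = modulus n a +>\<^bsub>type_ring\<^esub> f"

lemma residue_class_eq_iff:
  "residue_class n a f = residue_class n a g \<longleftrightarrow> (monom 1 n - [:a:]) dvd f - g"
proof -
  have cls: "residue_class n a h = {k * (monom 1 n - [:a:]) + h | k. True}" for h
    by (auto simp: residue_class_def a_r_coset_def' cgenideal_def type_ring_def)
  show ?thesis
  proof
    assume "residue_class n a f = residue_class n a g"
    moreover have "f \<in> residue_class n a f"
      unfolding cls by (auto intro: exI[of _ 0])
    ultimately have "f \<in> residue_class n a g"
      by simp
    then show "(monom 1 n - [:a:]) dvd f - g"
      unfolding cls by (auto simp: dvd_def mult.commute)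
  next
    assume "(monom 1 n - [:a:]) dvd f - g"
    then obtain k where k: "f = g + (monom 1 n - [:a:]) * k"
      by (auto simp: dvd_def algebra_simps)
    have "h * (monom 1 n - [:a:]) + f = (h + k) * (monom 1 n - [:a:]) + g"
      "h * (monom 1 n - [:a:]) + g = (h - k) * (monom 1 n - [:a:]) + f" for h
      by (simp_all add: k algebra_simps smult_add_right smult_diff_right)
    then show "residue_class n a f = residue_class n a g"
      unfolding cls by fastforce
  qed
qed

text \<open>The ideal of \<open>consta_ring n a\<close> generated by the classes of the polynomials in \<open>S\<close>.\<close>

definition gen_ideal :: "nat \<Rightarrow> 'r::comm_ring_1 \<Rightarrow> 'r poly set \<Rightarrow> 'r poly set set" where
  "gen_ideal n a S = Idl\<^bsub>consta_ring n a\<^esub> (residue_class n a ` S)"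

text \<open>Words of length \<open>n\<close> are lists; \<open>Poly [c\<^sub>0, \<dots>, c\<^sub>k]\<close> is the polynomial with constant
  coefficient \<open>c\<^sub>0\<close>.\<close>

definition words_of :: "nat \<Rightarrow> 'r::comm_ring_1 \<Rightarrow> 'r poly set set \<Rightarrow> 'r list set" where
  "words_of n a C = {c. length c = n \<and> residue_class n a (Poly c) \<in> C}"

definition dual_code :: "nat \<Rightarrow> 'r::comm_ring_1 list set \<Rightarrow> 'r list set" where
  "dual_code n W = {b. length b = n \<and> (\<forall>c\<in>W. (\<Sum>i<n. b ! i * c ! i) = 0)}"

definition annihilator :: "('b, 'c) ring_scheme \<Rightarrow> 'b set \<Rightarrow> 'b set" where
  "annihilator Q C = {x \<in> carrier Q. \<forall>c\<in>C. x \<otimes>\<^bsub>Q\<^esub> c = \<zero>\<^bsub>Q\<^esub>}"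

text \<open>For a set \<open>A\<close> of elements of \<open>consta_ring n a\<close>: the classes in \<open>consta_ring n b\<close> of the
  reciprocals of all representatives, of any degree, of elements of \<open>A\<close>.
  Note that \<open>reflect_poly f\<close> is \<open>x^k f(1/x)\<close> with \<open>k = degree f\<close>, also if \<open>f\<close> has zero constant
  coefficient.\<close>

definition reciprocal_set ::
  "nat \<Rightarrow> 'r::comm_ring_1 \<Rightarrow> 'r \<Rightarrow> 'r poly set set \<Rightarrow> 'r poly set set" where
  "reciprocal_set n a b A = {residue_class n b (reflect_poly f) | f. residue_class n a f \<in> A}"


section \<open>The polynomials of the statement\<close>

definition cubic :: "'a::comm_ring_1 \<Rightarrow> 'a poly" where
  "cubic a = monom 1 3 - [:a:]"

definition chi1_star ::
  "nat \<Rightarrow> nat \<Rightarrow> nat \<Rightarrow> nat \<Rightarrow> 'a::field \<Rightarrow> (nat \<Rightarrow> 'a) \<Rightarrow> (nat \<Rightarrow> 'a) \<Rightarrow> (nat \<Rightarrow> 'a) \<Rightarrow> 'a uvring poly"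
where
  "chi1_star p s l t a0 z0 z1 z2 =
     emb_poly (smult ((- a0) ^ (2 * p ^ s - l)) (cubic (inverse a0) ^ (2 * p ^ s - l)))
     - smult uu (emb_poly
         (smult ((- a0) ^ (2 * p ^ s + t - 2 * l)) (cubic (inverse a0) ^ (2 * p ^ s + t - 2 * l))
          * (\<Sum>k=0..l - t - 1. [:z0 k, z1 k, z2 k:]
               * smult ((- a0) ^ k) (cubic (inverse a0) ^ k)
               * monom 1 (3 * l - 3 * t - 3 * k - 2))))"

definition chi2_star ::
  "nat \<Rightarrow> nat \<Rightarrow> nat \<Rightarrow> nat \<Rightarrow> 'a::field \<Rightarrow> (nat \<Rightarrow> 'a) \<Rightarrow> (nat \<Rightarrow> 'a) \<Rightarrow> (nat \<Rightarrow> 'a) \<Rightarrow> 'a uvring poly"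
where
  "chi2_star p s l t a0 z0 z1 z2 =
     emb_poly (smult ((- a0) ^ (l - t)) (cubic (inverse a0) ^ (l - t)))
     - smult uu (emb_poly
         (\<Sum>k=0..2 * p ^ s - l - 1. [:z0 k, z1 k, z2 k:]
            * smult ((- a0) ^ k) (cubic (inverse a0) ^ k)
            * monom 1 (3 * l - 3 * t - 3 * k - 2)))"

text \<open>In the two definitions above \<open>[:z0 k, z1 k, z2 k:]\<close> is \<open>z2 k x^2 + z1 k x + z0 k\<close>. The
  subtractions on \<open>nat\<close> do not truncate in the ranges where the polynomials are used: there
  \<open>t < l < 2 p^s\<close>, with \<open>2 l \<le> 2 p^s + t\<close> for \<open>chi1_star\<close> and \<open>2 p^s + t < 2 l\<close> for \<open>chi2_star\<close>.\<close>

end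

theory Submission
  imports Defs "HOL-Computational_Algebra.Primes"
begin

text \<open>Write \<open>N = p^s\<close>, \<open>w = x^3 - \<alpha>\<^sub>0\<close>, \<open>F\<close> for the finite field and \<open>R = F[u,v] / (u^2, v^2)\<close>. Since
  \<open>\<alpha>\<^sub>0^N = \<alpha>\<^sub>1\<close>, the Frobenius map gives \<open>w^N = x^(3N) - \<alpha>\<^sub>1\<close>, which is \<open>v (\<alpha>\<^sub>3 + u \<alpha>\<^sub>4)\<close> modulo
  \<open>x^(3N) - \<alpha>\<close>. So \<open>v\<close> is a unit times \<open>w^N\<close>, and the ambient ring \<open>R[x] / (x^(3N) - \<alpha>)\<close> is
  \<open>F[x,u] / (w^(2N), u^2)\<close>: every element has a representative \<open>A + u B\<close> with \<open>A\<close>, \<open>B\<close> in \<open>F[x]\<close>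
  (\<open>normal_form\<close>), which vanishes iff \<open>w^(2N)\<close> divides both \<open>A\<close> and \<open>B\<close> (\<open>modulus_dvd_iff\<close>).

  In these coordinates the annihilator of \<open>w^l + u w^t Z\<close> is given by two divisibility conditions,
  \<open>w^(2N) dvd A w^l\<close> and \<open>w^(2N) dvd A w^t Z + B w^l\<close>. If \<open>2l \<le> 2N + t\<close>, their solutions are the
  multiples of \<open>w^(2N-l) - u w^(2N-2l+t) Z\<close> (\<open>annihilator_principal\<close>). If \<open>2l > 2N + t\<close> and \<open>Z\<close> is
  invertible, they are generated by \<open>w^(l-t) - u Z\<close> and \<open>u w^(2N-l)\<close>
  (\<open>annihilator_two_generators\<close>). In both cases the high terms of the expansion of \<open>Z\<close> in powers of
  \<open>w\<close> do not change the ideal, so the finite sum can be truncated.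

  The passage from the annihilator to the dual code is general. For \<open>a b = 1\<close> the substitution
  \<open>x \<mapsto> 1/x\<close> is a ring isomorphism from \<open>R[x] / (x^n - a)\<close> to \<open>R[x] / (x^n - b)\<close>, and the set of
  reciprocals of an ideal is its image (\<open>reciprocal_set_iff\<close>); in particular it is an ideal. The
  inner product of two words \<open>f\<close> and \<open>g\<close> is the constant coefficient of \<open>f(1/x) g(x)\<close>
  (\<open>fold_coeff_inner_product\<close>), so orthogonality to an ideal is the same as annihilating it
  (\<open>dual_code_eq_reciprocal_annihilator\<close>).

  It remains to apply \<open>x \<mapsto> 1/x\<close> to the generators and to clear denominators by a power of \<open>x\<close>. As
  \<open>x^3 w(1/x) = - \<alpha>\<^sub>0 (x^3 - 1/\<alpha>\<^sub>0)\<close>, this yields the polynomials \<open>chi1_star\<close> and \<open>chi2_star\<close> up to a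
  unit (\<open>chi1_star_passoc\<close>, \<open>chi2_star_passoc\<close>).\<close>

section \<open>Congruences\<close>

definition pcong :: "'r::comm_ring_1 \<Rightarrow> 'r \<Rightarrow> 'r \<Rightarrow> bool" where
  "pcong m x y \<longleftrightarrow> m dvd x - y"

lemma pcong_refl [simp]: "pcong m x x"
  by (simp add: pcong_def)

lemma pcong_sym: "pcong m x y \<Longrightarrow> pcong m y x"
  by (metis pcong_def dvd_minus_iff minus_diff_eq)

lemma pcong_trans [trans]: "pcong m x y \<Longrightarrow> pcong m y z \<Longrightarrow> pcong m x z"
  unfolding pcong_def using dvd_add[of m "x - y" "y - z"] by simp

lemma pcong_add: "pcong m x x' \<Longrightarrow> pcong m y y' \<Longrightarrow> pcong m (x + y) (x' + y')"
  unfolding pcong_def by (simp add: dvd_add add_diff_add)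

lemma pcong_diff: "pcong m x x' \<Longrightarrow> pcong m y y' \<Longrightarrow> pcong m (x - y) (x' - y')"
  unfolding pcong_def using dvd_diff[of m "x - x'" "y - y'"] by (simp add: algebra_simps)

lemma pcong_mult: "pcong m x x' \<Longrightarrow> pcong m y y' \<Longrightarrow> pcong m (x * y) (x' * y')"
proof -
  assume "pcong m x x'" "pcong m y y'"
  then have "m dvd (x - x') * y + x' * (y - y')"
    by (simp add: pcong_def)
  then show ?thesis by (simp add: pcong_def algebra_simps)
qed

lemma pcong_power: "pcong m x y \<Longrightarrow> pcong m (x ^ k) (y ^ k)"
  by (induction k) (auto intro: pcong_mult)

lemma pcong_sum: "(\<And>i. i \<in> I \<Longrightarrow> pcong m (f i) (g i)) \<Longrightarrow> pcong m (sum f I) (sum g I)"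
  by (induction I rule: infinite_finite_induct) (auto intro: pcong_add)

lemma pcong_smult: "pcong m f g \<Longrightarrow> pcong m (smult c f) (smult c g)"
  unfolding pcong_def by (metis dvd_smult smult_diff_right)

lemma pcong_0_iff: "pcong m x 0 \<longleftrightarrow> m dvd x"
  by (simp add: pcong_def)

lemma pcong_dvd: "pcong m x y \<Longrightarrow> m dvd x \<longleftrightarrow> m dvd y"
  by (metis pcong_0_iff pcong_sym pcong_trans)

lemma pcong_cancel:
  assumes "pcong m (x * e) 1" "pcong m (x * y) (x * z)"
  shows "pcong m y z"
proof -
  have e: "pcong m ((x * e) * u) u" for u
    using pcong_mult[OF assms(1) pcong_refl, of u] by simp
  have "pcong m y ((x * e) * y)"
    using e pcong_sym by blast
  also have "pcong m ((x * e) * y) ((x * e) * z)"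
    using pcong_mult[OF pcong_refl[of m e] assms(2)] by (simp add: mult_ac)
  also have "pcong m ((x * e) * z) z" by (rule e)
  finally show ?thesis .
qed

text \<open>Being associated by a factor that is a unit modulo \<open>m\<close>: such elements generate the same ideal of
  the quotient ring. Only this relation can be expected between the reciprocal of a generator and
  its image under \<open>x \<mapsto> 1/x\<close>, because a power of \<open>x\<close> and a scalar have to be cleared.\<close>

definition passoc :: "'r::comm_ring_1 \<Rightarrow> 'r \<Rightarrow> 'r \<Rightarrow> bool" where
  "passoc m x y \<longleftrightarrow> (\<exists>e e'. pcong m (e * e') 1 \<and> pcong m x (e * y))"

lemma passocI: "pcong m (e * e') 1 \<Longrightarrow> pcong m x (e * y) \<Longrightarrow> passoc m x y"
  by (auto simp: passoc_def)

lemma passoc_sym: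
  assumes "passoc m x y"
  shows "passoc m y x"
proof -
  obtain e e' where e: "pcong m (e * e') 1" and x: "pcong m x (e * y)"
    using assms by (auto simp: passoc_def)
  have "pcong m (1 * y) ((e * e') * y)"
    using e by (intro pcong_mult pcong_refl) (rule pcong_sym)
  also have "(e * e') * y = e' * (e * y)"
    by (simp only: mult_ac)
  also have "pcong m (e' * (e * y)) (e' * x)"
    using x by (intro pcong_mult pcong_refl) (rule pcong_sym)
  finally show ?thesis
    using e by (intro passocI[of m e' e]) (simp_all add: mult.commute)
qed

lemma pcong_pcompose: "pcong m g h \<Longrightarrow> pcong m (pcompose f g) (pcompose f h)"
  by (induction f) (auto simp: pcompose_pCons intro!: pcong_add pcong_mult)

lemma pcompose_monom: "pcompose (monom c k) g = smult c (g ^ k)"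
  for g :: "'r::comm_ring_1 poly"
  by (induction k) (simp_all add: monom_0 monom_Suc pcompose_pCons)

section \<open>The rings \<open>R[x] / (x^n - a)\<close>\<close>

definition consta_poly :: "nat \<Rightarrow> 'r::comm_ring_1 \<Rightarrow> 'r poly" where
  "consta_poly n a = monom 1 n - [:a:]"

lemma residue_eq_iff: "residue_class n a f = residue_class n a g \<longleftrightarrow> pcong (consta_poly n a) f g"
  by (simp add: residue_class_eq_iff pcong_def consta_poly_def)

lemma residue_class_hom:
  "residue_class n (a :: 'r::comm_ring_1) \<in> ring_hom type_ring (consta_ring n a)"
  unfolding consta_ring_def residue_class_def[abs_def]
  by (intro ideal.rcos_ring_hom cring.cgenideal_ideal cring_type_ring) (simp add: type_ring_def)

lemma residue_class_closed [simp]: "residue_class n a f \<in> carrier (consta_ring n a)"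
  using ring_hom_closed[OF residue_class_hom] by (auto simp: type_ring_def)

lemma residue_class_add:
  "residue_class n a f \<oplus>\<^bsub>consta_ring n a\<^esub> residue_class n a g = residue_class n a (f + g)"
  using ring_hom_add[OF residue_class_hom, of f g n a] by (simp add: type_ring_def)

lemma residue_class_mult:
  "residue_class n a f \<otimes>\<^bsub>consta_ring n a\<^esub> residue_class n a g = residue_class n a (f * g)"
  using ring_hom_mult[OF residue_class_hom, of f g n a] by (simp add: type_ring_def)

lemma residue_class_one: "\<one>\<^bsub>consta_ring n a\<^esub> = residue_class n a 1"
  using ring_hom_one[OF residue_class_hom, of n a] by (simp add: type_ring_def)

lemma residue_class_zero: "\<zero>\<^bsub>consta_ring n a\<^esub> = residue_class n a 0"
  using ring_hom_zero[OF residue_class_hom cring.axioms(1)[OF cring_type_ring]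
    cring.axioms(1)[OF cring_consta_ring], of n a]
  by (simp add: type_ring_def)

lemma residue_class_surj:
  assumes "X \<in> carrier (consta_ring n a)" obtains f where "X = residue_class n a f"
proof -
  have "carrier (consta_ring n a) = (\<Union>f. {residue_class n a f})"
    by (simp add: consta_ring_def residue_class_def FactRing_simps type_ring_def a_r_coset_def)
  then show ?thesis using assms that by blast
qed

lemma residue_class_eq_zero_iff:
  "residue_class n a f = \<zero>\<^bsub>consta_ring n a\<^esub> \<longleftrightarrow> consta_poly n a dvd f"
  by (simp add: residue_class_zero residue_eq_iff pcong_0_iff)

lemma residue_class_unitD:
  assumes "residue_class n a f \<in> Units (consta_ring n a)"
  obtains g where "pcong (consta_poly n a) (f * g) 1"
proof -
  obtain Y where Y: "Y \<in> carrier (consta_ring n a)"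
    and 1: "residue_class n a f \<otimes>\<^bsub>consta_ring n a\<^esub> Y = \<one>\<^bsub>consta_ring n a\<^esub>"
    using assms by (auto simp: Units_def)
  obtain g where "Y = residue_class n a g"
    using Y by (rule residue_class_surj)
  with 1 have "pcong (consta_poly n a) (f * g) 1"
    by (simp add: residue_class_mult residue_class_one residue_eq_iff)
  then show ?thesis by (rule that)
qed

text \<open>Ideals of the quotient ring are handled through the polynomials that represent their elements.\<close>

lemma ideal_consta_ringI:
  assumes sub: "J \<subseteq> carrier (consta_ring n a)"
    and zero: "residue_class n a 0 \<in> J"
    and add: "\<And>f g. residue_class n a f \<in> J \<Longrightarrow> residue_class n a g \<in> J \<Longrightarrow> residue_class n a (f + g) \<in> J"
    and mult: "\<And>f g. residue_class n a f \<in> J \<Longrightarrow> residue_class n a (g * f) \<in> J"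
  shows "ideal J (consta_ring n a)"
proof -
  interpret Q: cring "consta_ring n a" by (rule cring_consta_ring)
  have neg: "\<ominus>\<^bsub>consta_ring n a\<^esub> residue_class n a f = residue_class n a (- f)" for f
    by (rule Q.minus_equality) (auto simp: residue_class_add residue_class_zero)
  have rep: "\<exists>f. X = residue_class n a f" if "X \<in> J" for X
    using sub that residue_class_surj[of X n a] by blast
  show ?thesis
  proof (rule idealI[OF Q.ring_axioms])
    show "subgroup J (add_monoid (consta_ring n a))"
    proof (rule group.subgroupI[OF Q.add.group_axioms])
      show "J \<subseteq> carrier (add_monoid (consta_ring n a))"
        using sub by simp
      show "J \<noteq> {}"
        using zero by blast
    next
      fix X assume X: "X \<in> J"
      then obtain f where f: "X = residue_class n a f"
        using rep by blast
      have "residue_class n a (- 1 * f) \<in> J"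
        using X unfolding f by (rule mult)
      then show "inv\<^bsub>add_monoid (consta_ring n a)\<^esub> X \<in> J"
        using neg[of f] by (simp add: f a_inv_def)
    next
      fix X Y assume XY: "X \<in> J" "Y \<in> J"
      then obtain f g where fg: "X = residue_class n a f" "Y = residue_class n a g"
        using rep by blast
      have "residue_class n a (f + g) \<in> J"
        using XY unfolding fg by (rule add)
      then show "X \<otimes>\<^bsub>add_monoid (consta_ring n a)\<^esub> Y \<in> J"
        by (simp add: fg residue_class_add)
    qed
  next
    fix Y X assume XY: "Y \<in> J" "X \<in> carrier (consta_ring n a)"
    then obtain f g where fg: "X = residue_class n a f" "Y = residue_class n a g"
      using rep[of Y] residue_class_surj[of X n a] by blast
    have "residue_class n a (f * g) \<in> J"
      using XY(1) unfolding fg by (rule mult)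
    then show "X \<otimes>\<^bsub>consta_ring n a\<^esub> Y \<in> J" "Y \<otimes>\<^bsub>consta_ring n a\<^esub> X \<in> J"
      by (simp_all add: fg residue_class_mult mult.commute)
  qed
qed

lemma ideal_residue_mult:
  assumes "ideal J (consta_ring n a)" "residue_class n a f \<in> J"
  shows "residue_class n a (g * f) \<in> J"
  using ideal.I_l_closed[OF assms] by (metis residue_class_closed residue_class_mult)

lemma ideal_residue_add:
  assumes "ideal J (consta_ring n a)" "residue_class n a f \<in> J" "residue_class n a g \<in> J"
  shows "residue_class n a (f + g) \<in> J"
  using additive_subgroup.a_closed[OF ideal.axioms(1)[OF assms(1)] assms(2,3)]
  by (simp add: residue_class_add)

lemma ideal_residue_zero:
  assumes "ideal J (consta_ring n a)"
  shows "residue_class n a 0 \<in> J"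
  using additive_subgroup.zero_closed[OF ideal.axioms(1)[OF assms(1)]]
  by (simp add: residue_class_zero)

lemma ideal_subset_carrier:
  "ideal J (consta_ring n a) \<Longrightarrow> J \<subseteq> carrier (consta_ring n a)"
  by (meson additive_subgroup.a_subset ideal.axioms(1))

lemma subset_residueI:
  assumes "J \<subseteq> carrier (consta_ring n a)"
    and "\<And>f. residue_class n a f \<in> J \<Longrightarrow> residue_class n a f \<in> J'"
  shows "J \<subseteq> J'"
  using assms residue_class_surj by blast

lemma ideal_gen_ideal: "ideal (gen_ideal n a S) (consta_ring n a)"
  unfolding gen_ideal_def
  by (intro ring.genideal_ideal cring.axioms(1) cring_consta_ring) auto

lemma gen_ideal_generator:
  assumes "g \<in> S"
  shows "residue_class n a g \<in> gen_ideal n a S"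
proof -
  have "residue_class n a ` S \<subseteq> carrier (consta_ring n a)" by auto
  then have "residue_class n a ` S \<subseteq> gen_ideal n a S"
    unfolding gen_ideal_def
    by (rule ring.genideal_self[OF cring.axioms(1)[OF cring_consta_ring]])
  then show ?thesis using assms by blast
qed

lemma passoc_gen_ideal:
  assumes "f \<in> S" "passoc (consta_poly n a) g f"
  shows "residue_class n a g \<in> gen_ideal n a S"
proof -
  obtain e where "pcong (consta_poly n a) g (e * f)"
    using assms(2) by (auto simp: passoc_def)
  then show ?thesis
    using ideal_residue_mult[OF ideal_gen_ideal gen_ideal_generator[OF assms(1)], of n a e]
    by (simp add: residue_eq_iff[symmetric])
qed

lemma gen_ideal_minimal:
  assumes "ideal J (consta_ring n a)" "\<And>g. g \<in> S \<Longrightarrow> residue_class n a g \<in> J"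
  shows "gen_ideal n a S \<subseteq> J"
  unfolding gen_ideal_def using assms
  by (intro ring.genideal_minimal cring.axioms(1) cring_consta_ring) auto

lemma annihilator_iff:
  assumes "J \<subseteq> carrier (consta_ring n a)"
  shows "residue_class n a f \<in> annihilator (consta_ring n a) J \<longleftrightarrow>
     (\<forall>g. residue_class n a g \<in> J \<longrightarrow> consta_poly n a dvd f * g)"
proof -
  have "(\<forall>X\<in>J. P X) \<longleftrightarrow> (\<forall>g. residue_class n a g \<in> J \<longrightarrow> P (residue_class n a g))" for P
    using assms residue_class_surj by (metis subsetD)
  then show ?thesis
    by (simp add: annihilator_def residue_class_mult residue_class_eq_zero_iff)
qed

lemma ideal_annihilator:
  assumes "J \<subseteq> carrier (consta_ring n a)"
  shows "ideal (annihilator (consta_ring n a) J) (consta_ring n a)"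
proof (rule ideal_consta_ringI)
  show "annihilator (consta_ring n a) J \<subseteq> carrier (consta_ring n a)"
    by (auto simp: annihilator_def)
qed (auto simp: annihilator_iff[OF assms] distrib_right mult.assoc)

text \<open>It suffices to annihilate a generator: the elements killed by a fixed element form an ideal.\<close>

lemma annihilator_gen_ideal_iff:
  "residue_class n a f \<in> annihilator (consta_ring n a) (gen_ideal n a {G}) \<longleftrightarrow> consta_poly n a dvd f * G"
proof
  assume "residue_class n a f \<in> annihilator (consta_ring n a) (gen_ideal n a {G})"
  then show "consta_poly n a dvd f * G"
    using gen_ideal_generator[of G "{G}" n a]
    by (simp add: annihilator_iff ideal_subset_carrier ideal_gen_ideal)
next
  assume *: "consta_poly n a dvd f * G"
  let ?J = "annihilator (consta_ring n a) {residue_class n a f}"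
  have sub: "{residue_class n a f} \<subseteq> carrier (consta_ring n a)" by simp
  have J: "residue_class n a g \<in> ?J \<longleftrightarrow> consta_poly n a dvd f * g" for g
  proof -
    have "pcong (consta_poly n a) f f' \<Longrightarrow> consta_poly n a dvd f * g \<Longrightarrow> consta_poly n a dvd g * f'" for f'
      by (metis mult.commute pcong_dvd pcong_mult pcong_refl)
    then show ?thesis
      by (auto simp: annihilator_iff[OF sub] residue_eq_iff mult.commute dest: pcong_sym)
  qed
  have "gen_ideal n a {G} \<subseteq> ?J"
    using * by (intro gen_ideal_minimal ideal_annihilator sub) (simp_all add: J)
  then show "residue_class n a f \<in> annihilator (consta_ring n a) (gen_ideal n a {G})"
    using J by (auto simp: annihilator_iff ideal_subset_carrier ideal_gen_ideal)
qed

section \<open>The substitution of the inverse of the variable\<close>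

text \<open>Modulo \<open>x^n - b\<close> with \<open>a b = 1\<close> the inverse of \<open>x\<close> is \<open>a x^(n-1)\<close>. Substituting this polynomial
  therefore realises \<open>f(x) \<mapsto> f(1/x)\<close> as a ring homomorphism of polynomial rings; it induces an
  isomorphism from \<open>R[x] / (x^n - a)\<close> to \<open>R[x] / (x^n - b)\<close>. Unlike taking reciprocals, which
  depends on the degree of the representative, it respects addition and multiplication.\<close>

definition invert_var :: "nat \<Rightarrow> 'r::comm_ring_1 \<Rightarrow> 'r poly \<Rightarrow> 'r poly" where
  "invert_var n a f = pcompose f (monom a (n - 1))"

lemma pcong_monom_n: "pcong (consta_poly n a) (monom 1 1 ^ n) [:a:]"
  by (simp add: pcong_def consta_poly_def monom_power)

context
  fixes n :: nat and a b :: "'r::comm_ring_1"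
  assumes n: "n \<ge> 1" and ab: "a * b = 1"
begin

lemma x_times_inverse: "pcong (consta_poly n b) (monom 1 1 * monom a (n - 1)) 1"
proof -
  have "monom 1 1 * monom a (n - 1) = smult a (monom 1 1 ^ n)"
    using n by (simp add: mult_monom monom_power smult_monom)
  also have "pcong (consta_poly n b) \<dots> (smult a [:b:])"
    by (intro pcong_smult pcong_monom_n)
  finally show ?thesis using ab by (simp add: one_pCons)
qed

lemma x_power_times_inverse: "pcong (consta_poly n b) (monom 1 k * monom a (n - 1) ^ k) 1"
  using pcong_power[OF x_times_inverse, of k] by (simp add: power_mult_distrib monom_power)

lemma inverse_power_n: "pcong (consta_poly n b) (monom a (n - 1) ^ n) [:a:]"
proof (rule pcong_cancel)
  show "pcong (consta_poly n b) (monom 1 n * monom a (n - 1) ^ n) 1"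
    by (rule x_power_times_inverse)
  have "pcong (consta_poly n b) (monom 1 n * [:a:]) ([:b:] * [:a:])"
    using pcong_monom_n[of n b] by (intro pcong_mult) (simp_all add: monom_power)
  moreover have "[:b:] * [:a:] = 1"
    using ab by (simp add: mult.commute one_pCons)
  ultimately show "pcong (consta_poly n b) (monom 1 n * monom a (n - 1) ^ n) (monom 1 n * [:a:])"
    using x_power_times_inverse[of n] pcong_sym pcong_trans by metis
qed

text \<open>The map is well defined on classes because \<open>x^n - a\<close> goes to \<open>(1/x)^n - a\<close>, and
  \<open>(1/x)^n\<close> is the inverse of \<open>b\<close>.\<close>

lemma invert_var_cong:
  assumes "pcong (consta_poly n a) f g"
  shows "pcong (consta_poly n b) (invert_var n a f) (invert_var n a g)"
proof -
  obtain k where "f - g = consta_poly n a * k"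
    using assms by (auto simp: pcong_def dvd_def)
  then have "invert_var n a f - invert_var n a g = invert_var n a (consta_poly n a) * invert_var n a k"
    by (simp add: invert_var_def flip: pcompose_diff pcompose_mult)
  moreover have "consta_poly n b dvd invert_var n a (consta_poly n a)"
    using inverse_power_n
    by (simp add: invert_var_def consta_poly_def pcompose_diff pcompose_monom pcong_def)
  ultimately show ?thesis by (simp add: pcong_def)
qed

text \<open>The reason is \<open>x^d (1/x)^i = x^(d-i)\<close>. Allowing \<open>d\<close> to exceed the degree makes it possible to reverse
  several polynomials with the same power of \<open>x\<close>.\<close>

lemma reversal_cong:
  assumes "degree f \<le> d"
  shows "pcong (consta_poly n b) (\<Sum>i\<le>d. monom (coeff f i) (d - i)) (monom 1 d * invert_var n a f)"
proof -
  let ?y = "monom a (n - 1)"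
  have "pcong (consta_poly n b) (\<Sum>i\<le>d. monom (coeff f i) (d - i))
      (\<Sum>i\<le>d. smult (coeff f i) (monom 1 d * ?y ^ i))"
  proof (rule pcong_sum)
    fix i assume i: "i \<in> {..d}"
    have "monom 1 d * ?y ^ i = monom 1 (d - i) * (monom 1 i * ?y ^ i)"
      using i by (simp add: mult_monom flip: mult.assoc)
    also have "pcong (consta_poly n b) \<dots> (monom 1 (d - i) * 1)"
      by (intro pcong_mult pcong_refl x_power_times_inverse)
    finally have "pcong (consta_poly n b) (smult (coeff f i) (monom 1 (d - i)))
        (smult (coeff f i) (monom 1 d * ?y ^ i))"
      by (intro pcong_smult) (simp add: pcong_sym)
    then show "pcong (consta_poly n b) (monom (coeff f i) (d - i))
        (smult (coeff f i) (monom 1 d * ?y ^ i))"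
      by (simp add: smult_monom)
  qed
  also have "(\<Sum>i\<le>d. smult (coeff f i) (monom 1 d * ?y ^ i)) =
      monom 1 d * (\<Sum>i\<le>d. smult (coeff f i) (?y ^ i))"
    by (simp add: sum_distrib_left)
  also have "(\<Sum>i\<le>d. smult (coeff f i) (?y ^ i)) = invert_var n a f"
  proof -
    have "invert_var n a f = pcompose (\<Sum>i\<le>d. monom (coeff f i) i) ?y"
      by (simp add: invert_var_def poly_as_sum_of_monoms' assms)
    then show ?thesis
      by (simp add: pcompose_sum pcompose_monom)
  qed
  finally show ?thesis .
qed

lemma reflect_poly_cong:
  "pcong (consta_poly n b) (reflect_poly f) (monom 1 (degree f) * invert_var n a f)"
proof -
  have "reflect_poly f = (\<Sum>i\<le>degree f. monom (coeff f i) (degree f - i))"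
  proof (rule poly_eqI)
    fix k
    have "coeff (\<Sum>i\<le>degree f. monom (coeff f i) (degree f - i)) k =
        (\<Sum>i\<le>degree f. if degree f - i = k then coeff f i else 0)"
      by (simp add: coeff_sum)
    also have "\<dots> = (\<Sum>i\<le>degree f. if i = degree f - k \<and> k \<le> degree f then coeff f i else 0)"
      by (intro sum.cong) auto
    also have "\<dots> = coeff (reflect_poly f) k"
      by (auto simp: coeff_reflect_poly sum.delta')
    finally show "coeff (reflect_poly f) k = coeff (\<Sum>i\<le>degree f. monom (coeff f i) (degree f - i)) k" ..
  qed
  then show ?thesis by (simp add: reversal_cong)
qed

end

lemma invert_var_involution:
  assumes n: "n \<ge> 1" and ab: "a * b = (1 :: 'r::comm_ring_1)"
  shows "pcong (consta_poly n a) (invert_var n b (invert_var n a f)) f"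
proof -
  let ?x' = "monom b (n - 1)"
  have ba: "b * a = 1" using ab by (simp add: mult.commute)
  have "pcong (consta_poly n a) (smult a (?x' ^ (n - 1))) (monom 1 1)"
  proof (rule pcong_cancel[of _ ?x' "monom 1 1"])
    show "pcong (consta_poly n a) (?x' * monom 1 1) 1"
      using x_times_inverse[OF n ba] by (simp add: mult.commute)
    have "?x' * smult a (?x' ^ (n - 1)) = smult a (?x' ^ n)"
      using n by (metis mult_smult_right power_minus_mult mult.commute less_eq_Suc_le One_nat_def)
    also have "pcong (consta_poly n a) \<dots> (smult a [:b:])"
      by (intro pcong_smult inverse_power_n n ba)
    also have "smult a [:b:] = 1"
      using ab by (simp add: one_pCons)
    also have "pcong (consta_poly n a) 1 (?x' * monom 1 1)"
      using x_times_inverse[OF n ba] by (simp add: mult.commute pcong_sym)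
    finally show "pcong (consta_poly n a) (?x' * smult a (?x' ^ (n - 1))) (?x' * monom 1 1)" .
  qed
  then have "pcong (consta_poly n a) (pcompose f (smult a (?x' ^ (n - 1)))) (pcompose f (monom 1 1))"
    by (rule pcong_pcompose)
  moreover have "pcompose f (monom 1 1) = f"
    by (simp add: monom_Suc monom_0)
  moreover have "invert_var n b (invert_var n a f) = pcompose f (smult a (?x' ^ (n - 1)))"
    by (simp add: invert_var_def pcompose_monom flip: pcompose_assoc)
  ultimately show ?thesis by simp
qed

text \<open>By the pigeonhole principle two powers of \<open>b\<close> coincide. The order of \<open>b\<close> is used below to make a
  power of \<open>x\<close> trivial.\<close>

lemma finite_order:
  assumes "finite (UNIV :: 'r::comm_ring_1 set)" "a * b = (1 :: 'r)"
  obtains e where "e \<ge> 1" "b ^ e = 1"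
proof -
  have "\<not> inj (\<lambda>i. b ^ i)"
    using assms(1) finite_imageD finite_subset infinite_UNIV_nat subset_UNIV by metis
  then obtain i j where "b ^ i = b ^ j" "i < j"
    by (auto simp: inj_def) (metis nat_neq_iff)
  have "b ^ j = b ^ i * b ^ (j - i)"
    using \<open>i < j\<close> by (simp flip: power_add)
  with \<open>b ^ i = b ^ j\<close> have "a ^ i * b ^ i = a ^ i * (b ^ i * b ^ (j - i))"
    by simp
  moreover have "a ^ i * b ^ i = 1"
    using assms(2) by (simp flip: power_mult_distrib)
  ultimately show ?thesis
    using that[of "j - i"] \<open>i < j\<close> by (simp flip: mult.assoc)
qed

text \<open>The reciprocals of all representatives of an ideal form exactly its image under \<open>x \<mapsto> 1/x\<close>.
  A reciprocal differs from \<open>f(1/x)\<close> by \<open>x^(deg f)\<close>, which gives one inclusion. For the other, a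
  multiple of \<open>x^n - a\<close> is added to the representative \<open>f\<close> so that its degree becomes a multiple of
  \<open>n\<close> times the order of \<open>b\<close>; then \<open>x^(deg f) = 1\<close>, and the reciprocal is \<open>f(1/x)\<close> itself.\<close>

lemma reciprocal_set_iff:
  assumes n: "n \<ge> 1" and ab: "a * b = (1 :: 'r::comm_ring_1)" and fin: "finite (UNIV :: 'r set)"
    and J: "ideal J (consta_ring n a)"
  shows "residue_class n b g \<in> reciprocal_set n a b J \<longleftrightarrow> residue_class n a (invert_var n b g) \<in> J"
proof
  have ba: "b * a = 1" using ab by (simp add: mult.commute)
  assume "residue_class n b g \<in> reciprocal_set n a b J"
  then obtain f where f: "residue_class n a f \<in> J"
    and gf: "pcong (consta_poly n b) g (reflect_poly f)"
    by (auto simp: reciprocal_set_def residue_eq_iff)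
  have "pcong (consta_poly n b) g (monom 1 (degree f) * invert_var n a f)"
    using gf reflect_poly_cong[OF n ab] by (rule pcong_trans)
  then have "pcong (consta_poly n a) (invert_var n b g) (invert_var n b (monom 1 (degree f) * invert_var n a f))"
    by (rule invert_var_cong[OF n ba])
  also have "invert_var n b (monom 1 (degree f) * invert_var n a f) =
      invert_var n b (monom 1 (degree f)) * invert_var n b (invert_var n a f)"
    by (simp add: invert_var_def pcompose_mult)
  also have "pcong (consta_poly n a) \<dots> (invert_var n b (monom 1 (degree f)) * f)"
    by (intro pcong_mult pcong_refl invert_var_involution n ab)
  finally show "residue_class n a (invert_var n b g) \<in> J"
    using ideal_residue_mult[OF J f] by (simp add: residue_eq_iff[symmetric])
next
  have ba: "b * a = 1" using ab by (simp add: mult.commute)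
  assume g: "residue_class n a (invert_var n b g) \<in> J"
  obtain e where e: "e \<ge> 1" "b ^ e = 1"
    using finite_order[OF fin ab] .
  define h where "h = invert_var n b g"
  \<comment> \<open>The order of \<open>x\<close> divides \<open>n e\<close>; the last factor makes \<open>d\<close> exceed the degree of \<open>h\<close>.\<close>
  define d where "d = n * e * Suc (Suc (degree h))"
  define f where "f = h + monom 1 (d - n) * consta_poly n a"
  have "1 * 1 * Suc (Suc (degree h)) \<le> d"
    unfolding d_def by (intro mult_le_mono n e le_refl)
  moreover have nd: "n \<le> d"
  proof -
    have "n * (1 * 1) \<le> n * (e * Suc (Suc (degree h)))"
      using e by (intro mult_le_mono) auto
    then show ?thesis by (simp only: d_def mult.assoc mult_1_right)
  qed
  ultimately have d: "degree h < d" "n \<le> d" by simp_all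
  have shift: "monom 1 (d - n) * consta_poly n a = monom 1 d - monom a (d - n)"
    using nd by (simp add: consta_poly_def right_diff_distrib mult_monom smult_monom)
  have "degree f = d"
  proof (rule antisym)
    show "degree f \<le> d"
      unfolding f_def shift using d
      by (intro degree_add_le degree_diff_le) (auto intro: order_trans[OF degree_monom_le])
    have "coeff f d = 1"
      unfolding f_def shift using d n by (simp add: coeff_eq_0)
    then show "d \<le> degree f"
      by (intro le_degree) simp
  qed
  have "residue_class n a f = residue_class n a h"
    by (simp add: residue_eq_iff pcong_def f_def)
  then have f: "residue_class n a f \<in> J"
    using g by (simp add: h_def)
  have "pcong (consta_poly n b) (monom 1 d) 1"
  proof -
    have "monom 1 d = (monom 1 1 ^ n) ^ (e * Suc (Suc (degree h)))"
      by (simp only: d_def monom_power power_one mult_1 mult.assoc)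
    also have "pcong (consta_poly n b) \<dots> ([:b:] ^ (e * Suc (Suc (degree h))))"
      by (intro pcong_power pcong_monom_n)
    also have "[:b:] ^ (e * Suc (Suc (degree h))) = 1"
      by (simp only: poly_const_pow power_mult e(2) power_one one_pCons)
    finally show ?thesis .
  qed
  then have one: "pcong (consta_poly n b) (monom 1 d * invert_var n a f) (1 * invert_var n a f)"
    by (intro pcong_mult) simp_all
  have "pcong (consta_poly n b) (reflect_poly f) (monom 1 d * invert_var n a f)"
    using reflect_poly_cong[OF n ab, of f] \<open>degree f = d\<close> by simp
  also note one
  also have "1 * invert_var n a f = invert_var n a f" by simp
  also have "pcong (consta_poly n b) (invert_var n a f) (invert_var n a h)"
    by (intro invert_var_cong n ab) (simp add: pcong_def f_def)
  also have "pcong (consta_poly n b) (invert_var n a h) g"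
    unfolding h_def by (intro invert_var_involution n ba)
  finally have "residue_class n b g = residue_class n b (reflect_poly f)"
    by (simp add: residue_eq_iff pcong_sym)
  then show "residue_class n b g \<in> reciprocal_set n a b J"
    using f by (auto simp: reciprocal_set_def)
qed

lemma reciprocal_set_subset: "reciprocal_set n a b J \<subseteq> carrier (consta_ring n b)"
  by (auto simp: reciprocal_set_def)

lemma ideal_reciprocal_set:
  assumes "n \<ge> 1" "a * b = (1 :: 'r::comm_ring_1)" "finite (UNIV :: 'r set)"
    and J: "ideal J (consta_ring n a)"
  shows "ideal (reciprocal_set n a b J) (consta_ring n b)"
  by (rule ideal_consta_ringI[OF reciprocal_set_subset])
    (simp_all add: reciprocal_set_iff[OF assms] invert_var_def pcompose_add pcompose_mult
      ideal_residue_zero[OF J] ideal_residue_add[OF J] ideal_residue_mult[OF J])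

text \<open>One inclusion holds because the image of an ideal is an ideal. The other is the same inclusion for
  the inverse substitution.\<close>

lemma reciprocal_set_gen_ideal:
  assumes n: "n \<ge> 1" and ab: "a * b = (1 :: 'r::comm_ring_1)" and fin: "finite (UNIV :: 'r set)"
    and ST: "\<And>f. f \<in> S \<Longrightarrow> \<exists>g\<in>T. passoc (consta_poly n b) g (invert_var n a f)"
    and TS: "\<And>g. g \<in> T \<Longrightarrow> \<exists>f\<in>S. passoc (consta_poly n b) g (invert_var n a f)"
  shows "reciprocal_set n a b (gen_ideal n a S) = gen_ideal n b T"
proof
  have ba: "b * a = 1" using ab by (simp add: mult.commute)
  note I = ideal_gen_ideal
  note mem = reciprocal_set_iff[OF n ab fin I]
  note mem' = reciprocal_set_iff[OF n ba fin I]
  show "gen_ideal n b T \<subseteq> reciprocal_set n a b (gen_ideal n a S)"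
  proof (rule gen_ideal_minimal[OF ideal_reciprocal_set[OF n ab fin I]])
    fix g assume "g \<in> T"
    then obtain f where f: "f \<in> S" and "passoc (consta_poly n b) g (invert_var n a f)"
      using TS by blast
    then obtain e where "pcong (consta_poly n b) g (e * invert_var n a f)"
      by (auto simp: passoc_def)
    then have "pcong (consta_poly n a) (invert_var n b g) (invert_var n b (e * invert_var n a f))"
      by (rule invert_var_cong[OF n ba])
    also have "invert_var n b (e * invert_var n a f) =
        invert_var n b e * invert_var n b (invert_var n a f)"
      by (simp add: invert_var_def pcompose_mult)
    also have "pcong (consta_poly n a) \<dots> (invert_var n b e * f)"
      by (intro pcong_mult pcong_refl invert_var_involution n ab)
    finally have "residue_class n a (invert_var n b g) \<in> gen_ideal n a S"
      using ideal_residue_mult[OF I gen_ideal_generator[OF f]] by (simp add: residue_eq_iff[symmetric])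
    then show "residue_class n b g \<in> reciprocal_set n a b (gen_ideal n a S)"
      by (simp add: mem)
  qed
  have *: "gen_ideal n a S \<subseteq> reciprocal_set n b a (gen_ideal n b T)"
  proof (rule gen_ideal_minimal[OF ideal_reciprocal_set[OF n ba fin I]])
    fix f assume "f \<in> S"
    then have "residue_class n b (invert_var n a f) \<in> gen_ideal n b T"
      using ST passoc_sym passoc_gen_ideal by blast
    then show "residue_class n a f \<in> reciprocal_set n b a (gen_ideal n b T)"
      by (simp add: mem')
  qed
  show "reciprocal_set n a b (gen_ideal n a S) \<subseteq> gen_ideal n b T"
  proof (rule subset_residueI[OF reciprocal_set_subset])
    fix g assume "residue_class n b g \<in> reciprocal_set n a b (gen_ideal n a S)"
    then have "residue_class n a (invert_var n b g) \<in> gen_ideal n a S"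
      by (simp add: mem)
    then have "residue_class n b (invert_var n a (invert_var n b g)) \<in> gen_ideal n b T"
      using * by (auto simp: mem')
    then show "residue_class n b g \<in> gen_ideal n b T"
      using invert_var_involution[OF n ba, of g] by (simp add: residue_eq_iff[symmetric])
  qed
qed

section \<open>Duality\<close>

text \<open>The coefficient of \<open>x^j\<close> in the remainder of \<open>f\<close> modulo \<open>x^n - a\<close>, for \<open>j < n\<close>: the coefficients
  of \<open>f\<close> are folded by \<open>x^n = a\<close>. The explicit formula makes linearity evident.\<close>

definition fold_coeff :: "nat \<Rightarrow> 'r::comm_ring_1 \<Rightarrow> nat \<Rightarrow> 'r poly \<Rightarrow> 'r" where
  "fold_coeff n a j f = (\<Sum>i\<le>degree f. coeff f i * (if i mod n = j then a ^ (i div n) else 0))"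

lemma fold_coeff_altdef:
  assumes "degree f \<le> d"
  shows "fold_coeff n a j f = (\<Sum>i\<le>d. coeff f i * (if i mod n = j then a ^ (i div n) else 0))"
  unfolding fold_coeff_def using assms
  by (intro sum.mono_neutral_left) (auto simp: coeff_eq_0)

lemma fold_coeff_0 [simp]: "fold_coeff n a j 0 = 0"
  by (simp add: fold_coeff_def)

lemma fold_coeff_add: "fold_coeff n a j (f + g) = fold_coeff n a j f + fold_coeff n a j g"
proof -
  let ?d = "max (degree f) (degree g)"
  have "degree (f + g) \<le> ?d" by (rule degree_add_le_max)
  then show ?thesis
    by (simp add: fold_coeff_altdef[of _ ?d] distrib_right sum.distrib)
qed

lemma fold_coeff_sum: "fold_coeff n a j (sum f I) = (\<Sum>i\<in>I. fold_coeff n a j (f i))"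
  by (induction I rule: infinite_finite_induct) (simp_all add: fold_coeff_add)

lemma fold_coeff_monom:
  "fold_coeff n a j (monom c i) = c * (if i mod n = j then a ^ (i div n) else 0)"
proof -
  have "fold_coeff n a j (monom c i) =
      (\<Sum>k\<le>i. if k = i then c * (if i mod n = j then a ^ (i div n) else 0) else 0)"
    unfolding fold_coeff_altdef[OF degree_monom_le[of c i]]
    by (intro sum.cong) auto
  then show ?thesis by (simp only: sum.delta finite_atMost atMost_iff order_refl if_True)
qed

lemma poly_sum_monom: obtains I c where "finite I" "f = (\<Sum>i\<in>I. monom (c i) (i::nat))"
  using poly_as_sum_of_monoms[of f] by (metis finite_atMost)

text \<open>By linearity it is enough to know how a functional changes under a shift of monomials.\<close>

lemma fold_coeff_monom_mult:
  assumes "\<And>i. fold_coeff n a j (monom 1 (i + k)) = e * fold_coeff n a j' (monom 1 i)"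
  shows "fold_coeff n a j (monom 1 k * f) = e * fold_coeff n a j' f"
proof -
  have *: "fold_coeff n a j (monom 1 k * monom c i) = e * fold_coeff n a j' (monom c i)" for c i
    using arg_cong[OF assms[of i], of "\<lambda>u. c * u"]
    by (simp add: mult_monom fold_coeff_monom add.commute mult_ac)
  obtain I c where "f = (\<Sum>i\<in>I. monom (c i) i)"
    by (rule poly_sum_monom)
  then show ?thesis
    by (simp add: sum_distrib_left fold_coeff_sum *)
qed

lemma fold_coeff_consta_poly_dvd:
  assumes n: "n \<ge> 1" and "consta_poly n a dvd f"
  shows "fold_coeff n a j f = 0"
proof -
  obtain g where g: "f = consta_poly n a * g"
    using assms by (auto simp: dvd_def)
  have 1: "fold_coeff n a j (monom 1 n * g) = a * fold_coeff n a j g"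
    by (rule fold_coeff_monom_mult) (use n in \<open>simp add: fold_coeff_monom\<close>)
  have 2: "fold_coeff n a j (smult c g) = c * fold_coeff n a j g" for c
    unfolding fold_coeff_altdef[OF degree_smult_le] fold_coeff_altdef[OF order_refl, of _ _ _ g]
    by (simp add: sum_distrib_left mult.assoc)
  have "fold_coeff n a j (f + smult a g) = fold_coeff n a j (monom 1 n * g)"
    by (simp add: g consta_poly_def algebra_simps)
  then show ?thesis
    by (simp add: fold_coeff_add 1 2)
qed

lemma pcong_fold_coeff:
  assumes n: "n \<ge> 1"
  shows "pcong (consta_poly n a) f (\<Sum>j<n. monom (fold_coeff n a j f) j)"
proof -
  have mon: "pcong (consta_poly n a) (monom c i) (\<Sum>j<n. monom (fold_coeff n a j (monom c i)) j)" for c i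
  proof -
    have "monom c i = (monom 1 1 ^ n) ^ (i div n) * monom c (i mod n)"
      by (simp add: monom_power mult_monom)
    also have "pcong (consta_poly n a) \<dots> ([:a:] ^ (i div n) * monom c (i mod n))"
      by (intro pcong_mult pcong_power pcong_monom_n pcong_refl)
    also have "[:a:] ^ (i div n) * monom c (i mod n) = monom (c * a ^ (i div n)) (i mod n)"
      by (simp add: poly_const_pow smult_monom mult.commute)
    also have "\<dots> = (\<Sum>j<n. if j = i mod n then monom (c * a ^ (i div n)) (i mod n) else 0)"
      using n by simp
    also have "\<dots> = (\<Sum>j<n. monom (fold_coeff n a j (monom c i)) j)"
      by (intro sum.cong) (auto simp: fold_coeff_monom)
    finally show ?thesis .
  qed
  have "f = (\<Sum>i\<le>degree f. monom (coeff f i) i)"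
    by (simp add: poly_as_sum_of_monoms)
  also have "pcong (consta_poly n a) \<dots> (\<Sum>i\<le>degree f. \<Sum>j<n. monom (fold_coeff n a j (monom (coeff f i) i)) j)"
    by (intro pcong_sum mon)
  also have "\<dots> = (\<Sum>j<n. monom (fold_coeff n a j (\<Sum>i\<le>degree f. monom (coeff f i) i)) j)"
    by (subst sum.swap) (simp add: fold_coeff_sum monom_sum)
  also have "\<dots> = (\<Sum>j<n. monom (fold_coeff n a j f) j)"
    by (simp add: poly_as_sum_of_monoms)
  finally show ?thesis .
qed

text \<open>The bilinear form \<open>(g, f) \<mapsto> fold_coeff n a 0 (g * f)\<close> is nondegenerate on the quotient ring: shifting
  by \<open>x^(n-j)\<close> moves the \<open>j\<close>-th coefficient of the remainder to the constant one, up to the unit \<open>a\<close>.\<close>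

lemma consta_poly_dvd_iff_fold_coeff:
  assumes n: "n \<ge> 1" and ab: "a * b = (1::'r::comm_ring_1)"
  shows "consta_poly n a dvd f \<longleftrightarrow> (\<forall>k. fold_coeff n a 0 (monom 1 k * f) = 0)"
proof
  assume "consta_poly n a dvd f"
  then show "\<forall>k. fold_coeff n a 0 (monom 1 k * f) = 0"
    by (simp add: fold_coeff_consta_poly_dvd[OF n])
next
  assume *: "\<forall>k. fold_coeff n a 0 (monom 1 k * f) = 0"
  have "fold_coeff n a j f = 0" if j: "j < n" for j
  proof -
    have "fold_coeff n a 0 (monom 1 (n - j) * f) = a * fold_coeff n a j f"
    proof (rule fold_coeff_monom_mult)
      fix i
      have "(i + (n - j)) mod n = 0 \<longleftrightarrow> i mod n = j"
      proof -
        have "i mod n < n" using n by simp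
        then show ?thesis
        proof (cases "i mod n < j")
          case True
          then have "(i mod n + (n - j)) mod n = i mod n + (n - j)"
            using j by (intro mod_less) linarith
          then have "(i + (n - j)) mod n = i mod n + (n - j)"
            by (simp only: mod_add_left_eq)
          then show ?thesis using True j by simp
        next
          case False
          then have "i mod n + (n - j) = (i mod n - j) + n"
            using j by linarith
          moreover have "(i mod n - j + n) mod n = i mod n - j"
            using \<open>i mod n < n\<close> by simp
          ultimately have "(i mod n + (n - j)) mod n = i mod n - j"
            by simp
          then have "(i + (n - j)) mod n = i mod n - j"
            by (simp only: mod_add_left_eq)
          then show ?thesis using False by simp
        qed
      qed
      moreover have "(i + (n - j)) div n = Suc (i div n)" if "i mod n = j"
      proof -
        have "i + (n - j) = n * Suc (i div n)"
          using that j mult_div_mod_eq[of n i] by (simp add: algebra_simps)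
        then show ?thesis using n by (metis nonzero_mult_div_cancel_left not_one_le_zero)
      qed
      ultimately show "fold_coeff n a 0 (monom 1 (i + (n - j))) = a * fold_coeff n a j (monom 1 i)"
        by (simp add: fold_coeff_monom)
    qed
    then have "b * (a * fold_coeff n a j f) = 0"
      using * by simp
    then show ?thesis
      using ab by (metis mult.assoc mult.commute mult_1)
  qed
  then show "consta_poly n a dvd f"
    using pcong_fold_coeff[OF n, of a f] by (simp add: pcong_0_iff)
qed

text \<open>The constant coefficient of \<open>u(1/x) w(x)\<close> collects the terms \<open>u\<^sub>i w\<^sub>j x^(j-i)\<close> with \<open>i = j\<close>, since
  \<open>\<bar>j - i\<bar> < n\<close>.\<close>

lemma fold_coeff_inner_product:
  assumes n: "n \<ge> 1" and ab: "a * b = (1::'r::comm_ring_1)"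
    and len: "length us = n" "length ws = n"
  shows "fold_coeff n a 0 (invert_var n b (Poly us) * Poly ws) = (\<Sum>i<n. us ! i * ws ! i)"
proof -
  have Poly: "Poly ws = (\<Sum>i<n. monom (ws ! i) i)" if "length ws = n" for ws :: "'r list"
    by (rule poly_eqI) (use that in \<open>auto simp: coeff_sum nth_default_def\<close>)
  have entry: "fold_coeff n a 0 (smult u (monom b (n - 1) ^ i) * monom w j) = (if j = i then u * w else 0)"
    if ij: "i < n" "j < n" for i j u w
  proof -
    have "((n - 1) * i + j) mod n = 0 \<longleftrightarrow> j = i"
    proof
      assume "((n - 1) * i + j) mod n = 0"
      then have "n dvd (n - 1) * i + j" by auto
      then have "int n dvd int ((n - 1) * i + j)" by (simp only: int_dvd_int_iff)
      moreover have "int ((n - 1) * i + j) = int n * int i + (int j - int i)"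
        using n by (cases n) (simp_all add: algebra_simps)
      ultimately have "int n dvd int j - int i"
        by (metis dvd_add_right_iff dvd_triv_left)
      moreover have "\<bar>int j - int i\<bar> < int n" using ij by linarith
      ultimately show "j = i"
        using zdvd_not_zless[of "\<bar>int j - int i\<bar>" "int n"] by auto
    next
      assume "j = i"
      then have "(n - 1) * i + j = n * i" using n by (simp add: algebra_simps)
      then show "((n - 1) * i + j) mod n = 0" by simp
    qed
    moreover have "((n - 1) * i + i) div n = i"
    proof -
      have "(n - 1) * i + i = n * i" using n by (simp add: algebra_simps)
      then show ?thesis using n by simp
    qed
    moreover have "b ^ i * a ^ i = 1"
      using ab by (simp add: mult.commute flip: power_mult_distrib)
    then have "u * b ^ i * w * a ^ i = u * w"
      by (metis mult.assoc mult.commute mult_1_right)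
    ultimately show ?thesis
      by (auto simp: monom_power smult_monom mult_monom fold_coeff_monom)
  qed
  have "invert_var n b (Poly us) = (\<Sum>i<n. smult (us ! i) (monom b (n - 1) ^ i))"
    by (simp add: invert_var_def Poly len pcompose_sum pcompose_monom)
  then have "fold_coeff n a 0 (invert_var n b (Poly us) * Poly ws) =
      (\<Sum>i<n. \<Sum>j<n. fold_coeff n a 0 (smult (us ! i) (monom b (n - 1) ^ i) * monom (ws ! j) j))"
    by (simp only: Poly len sum_product fold_coeff_sum)
  also have "\<dots> = (\<Sum>i<n. \<Sum>j<n. if j = i then us ! i * ws ! j else 0)"
    by (intro sum.cong refl) (simp only: entry lessThan_iff)
  also have "\<dots> = (\<Sum>i<n. us ! i * ws ! i)"
    by simp
  finally show ?thesis .
qed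

lemma residue_class_word:
  assumes "n \<ge> 1"
  obtains c where "length c = n" "residue_class n a f = residue_class n a (Poly c)"
proof
  let ?c = "map (\<lambda>j. fold_coeff n a j f) [0..<n]"
  show "length ?c = n" by simp
  have "Poly ?c = (\<Sum>j<n. monom (fold_coeff n a j f) j)"
    by (rule poly_eqI) (auto simp: coeff_sum nth_default_def)
  then show "residue_class n a f = residue_class n a (Poly ?c)"
    using pcong_fold_coeff[OF assms] by (simp add: residue_eq_iff)
qed

text \<open>A word \<open>u\<close> is orthogonal to the code iff the constant coefficient of \<open>u(1/x) c(x)\<close> vanishes for all
  codewords \<open>c\<close>. As the code is closed under multiplication by \<open>x\<close>, this makes all the
  coefficients vanish, so that \<open>u(1/x)\<close> annihilates the code.\<close>

lemma dual_code_eq_reciprocal_annihilator: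
  assumes n: "n \<ge> 1" and ab: "a * b = (1::'r::comm_ring_1)" and fin: "finite (UNIV :: 'r set)"
    and C: "ideal C (consta_ring n a)"
  shows "words_of n b (reciprocal_set n a b (annihilator (consta_ring n a) C)) =
    dual_code n (words_of n a C)"
proof -
  have sub: "C \<subseteq> carrier (consta_ring n a)" using C by (rule ideal_subset_carrier)
  have "residue_class n b (Poly us) \<in> reciprocal_set n a b (annihilator (consta_ring n a) C) \<longleftrightarrow>
      (\<forall>c\<in>words_of n a C. (\<Sum>i<n. us ! i * c ! i) = 0)" (is "?L \<longleftrightarrow> ?R") if len: "length us = n" for us
  proof -
    let ?v = "invert_var n b (Poly us)"
    have "?L \<longleftrightarrow> (\<forall>g. residue_class n a g \<in> C \<longrightarrow> consta_poly n a dvd ?v * g)"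
      by (simp add: reciprocal_set_iff[OF n ab fin ideal_annihilator[OF sub]] annihilator_iff[OF sub])
    also have "\<dots> \<longleftrightarrow> (\<forall>g. residue_class n a g \<in> C \<longrightarrow> fold_coeff n a 0 (?v * g) = 0)"
    proof (intro iffI allI impI)
      fix g assume "\<forall>g. residue_class n a g \<in> C \<longrightarrow> consta_poly n a dvd ?v * g" "residue_class n a g \<in> C"
      then show "fold_coeff n a 0 (?v * g) = 0"
        using fold_coeff_consta_poly_dvd[OF n] by blast
    next
      fix g assume *: "\<forall>g. residue_class n a g \<in> C \<longrightarrow> fold_coeff n a 0 (?v * g) = 0"
        and g: "residue_class n a g \<in> C"
      have "fold_coeff n a 0 (monom 1 k * (?v * g)) = 0" for k
        using * ideal_residue_mult[OF C g, of "monom 1 k"]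
        by (simp only: mult.left_commute[of "monom 1 k" ?v])
      then show "consta_poly n a dvd ?v * g"
        by (simp add: consta_poly_dvd_iff_fold_coeff[OF n ab])
    qed
    also have "\<dots> \<longleftrightarrow> (\<forall>c. length c = n \<longrightarrow> residue_class n a (Poly c) \<in> C \<longrightarrow>
        fold_coeff n a 0 (?v * Poly c) = 0)"
    proof (intro iffI allI impI)
      fix g assume *: "\<forall>c. length c = n \<longrightarrow> residue_class n a (Poly c) \<in> C \<longrightarrow>
          fold_coeff n a 0 (?v * Poly c) = 0" and g: "residue_class n a g \<in> C"
      obtain c where c: "length c = n" "residue_class n a g = residue_class n a (Poly c)"
        using residue_class_word[OF n] .
      then have "consta_poly n a dvd ?v * (g - Poly c)"
        by (simp add: residue_eq_iff pcong_def)
      then have "fold_coeff n a 0 (?v * (g - Poly c)) = 0"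
        by (rule fold_coeff_consta_poly_dvd[OF n])
      moreover have "?v * g = ?v * (g - Poly c) + ?v * Poly c"
        by (simp add: algebra_simps)
      ultimately show "fold_coeff n a 0 (?v * g) = 0"
        using * c g by (simp add: fold_coeff_add)
    qed blast
    also have "\<dots> \<longleftrightarrow> ?R"
      by (auto simp: words_of_def fold_coeff_inner_product[OF n ab len])
    finally show ?thesis .
  qed
  then show ?thesis
    by (auto simp: words_of_def[of n b] dual_code_def)
qed

section \<open>Polynomials over \<open>F[u,v] / (u^2, v^2)\<close>\<close>

lemma emb_0 [simp]: "emb 0 = 0" and emb_1 [simp]: "emb 1 = 1"
  and emb_add: "emb (a + b) = emb a + emb b" and emb_mult: "emb (a * b) = emb a * emb b"
  by (simp_all add: emb_def zero_uvring_def one_uvring_def)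

lemma emb_sum: "emb (sum f I) = (\<Sum>i\<in>I. emb (f i))"
  by (induction I rule: infinite_finite_induct) (simp_all add: emb_add)

lemma emb_poly_add: "emb_poly (f + g) = emb_poly f + emb_poly g"
  by (rule poly_eqI) (simp add: coeff_map_poly emb_add)

lemma emb_poly_mult: "emb_poly (f * g) = emb_poly f * emb_poly g"
  by (rule poly_eqI) (simp add: coeff_map_poly coeff_mult emb_sum emb_mult)

lemma emb_poly_sum: "emb_poly (sum f I) = (\<Sum>i\<in>I. emb_poly (f i))"
  by (induction I rule: infinite_finite_induct) (simp_all add: emb_poly_add)

definition uv_poly :: "'a::comm_ring_1 poly \<Rightarrow> 'a poly \<Rightarrow> 'a poly \<Rightarrow> 'a poly \<Rightarrow> 'a uvring poly" where
  "uv_poly f0 f1 f2 f3 =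
     emb_poly f0 + smult uu (emb_poly f1) + smult vv (emb_poly f2) + smult (uu * vv) (emb_poly f3)"

lemma coeff_uv_poly:
  "coeff (uv_poly f0 f1 f2 f3) k = UV (coeff f0 k) (coeff f1 k) (coeff f2 k) (coeff f3 k)"
  by (simp add: uv_poly_def coeff_map_poly uvring_decomp)

lemma uv_poly_eq_iff:
  "uv_poly f0 f1 f2 f3 = uv_poly g0 g1 g2 g3 \<longleftrightarrow> f0 = g0 \<and> f1 = g1 \<and> f2 = g2 \<and> f3 = g3"
  by (auto simp: poly_eq_iff coeff_uv_poly)

lemma uv_poly_surj: obtains f0 f1 f2 f3 where "f = uv_poly f0 f1 f2 f3"
proof
  let ?c = "\<lambda>sel. map_poly sel f"
  show "f = uv_poly
      (?c (\<lambda>x. case x of UV a b c d \<Rightarrow> a)) (?c (\<lambda>x. case x of UV a b c d \<Rightarrow> b))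
      (?c (\<lambda>x. case x of UV a b c d \<Rightarrow> c)) (?c (\<lambda>x. case x of UV a b c d \<Rightarrow> d))"
    by (rule poly_eqI) (simp add: coeff_uv_poly coeff_map_poly zero_uvring_def split: uvring.split)
qed

lemma uv_poly_add:
  "uv_poly f0 f1 f2 f3 + uv_poly g0 g1 g2 g3 = uv_poly (f0 + g0) (f1 + g1) (f2 + g2) (f3 + g3)"
  by (rule poly_eqI) (simp add: coeff_uv_poly)

lemma uv_poly_diff:
  "uv_poly f0 f1 f2 f3 - uv_poly g0 g1 g2 g3 = uv_poly (f0 - g0) (f1 - g1) (f2 - g2) (f3 - g3)"
  by (rule poly_eqI) (simp add: coeff_uv_poly)

lemma UV_sum: "(\<Sum>i\<in>I. UV (f i) (g i) (h i) (k i)) = UV (sum f I) (sum g I) (sum h I) (sum k I)"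
  by (induction I rule: infinite_finite_induct) (simp_all add: zero_uvring_def)

lemma uv_poly_mult:
  "uv_poly f0 f1 f2 f3 * uv_poly g0 g1 g2 g3 =
     uv_poly (f0 * g0) (f0 * g1 + f1 * g0) (f0 * g2 + f2 * g0)
       (f0 * g3 + f1 * g2 + f2 * g1 + f3 * g0)"
  by (rule poly_eqI) (simp add: coeff_uv_poly coeff_mult UV_sum sum.distrib)

lemma uv_poly_1: "uv_poly 1 0 0 0 = 1"
  and emb_poly_eq_uv_poly: "emb_poly f = uv_poly f 0 0 0"
  and smult_uu_emb_poly_eq_uv_poly: "smult uu (emb_poly f) = uv_poly 0 f 0 0"
  by (simp_all add: uv_poly_def)

text \<open>Let \<open>M = W - v (c + u d)\<close> with \<open>c\<close> a unit. Modulo \<open>M\<close>, the element \<open>W\<close> is a unit times \<open>v\<close>. Hence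
  \<open>v\<close> can be eliminated in favour of \<open>W\<close>, and \<open>v^2 = 0\<close> turns into \<open>W^2 = 0\<close>: the quotient ring is \<open>F[x,u] / (W^2, u^2)\<close>. The two lemmas say this in terms of
  representatives \<open>A + u B\<close>.\<close>

context
  fixes W c d c' :: "'a::comm_ring_1 poly" and M :: "'a uvring poly"
  assumes M: "M = uv_poly W 0 (- c) (- d)" and c': "c * c' = 1"
begin

lemma modulus_dvd_iff: "M dvd uv_poly A B 0 0 \<longleftrightarrow> W ^ 2 dvd A \<and> W ^ 2 dvd B"
proof
  assume "M dvd uv_poly A B 0 0"
  then obtain g where g: "uv_poly A B 0 0 = M * g" by (auto simp: dvd_def)
  obtain g0 g1 g2 g3 where "g = uv_poly g0 g1 g2 g3" by (rule uv_poly_surj)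
  with g have A: "A = W * g0" and B: "B = W * g1" and v: "W * g2 = c * g0"
    and uv: "W * g3 = c * g1 + d * g0"
    by (auto simp: M uv_poly_mult uv_poly_eq_iff algebra_simps)
  have g0: "g0 = W * (c' * g2)"
  proof -
    have "g0 = (c * c') * g0" by (simp add: c')
    also have "\<dots> = c' * (W * g2)" by (simp only: v mult_ac)
    finally show ?thesis by (simp only: mult_ac)
  qed
  have "W * (c' * (g3 - d * c' * g2)) = c' * (W * g3 - d * g0)"
    unfolding g0 by (simp add: algebra_simps)
  also have "\<dots> = c * c' * g1"
    unfolding uv by (simp add: mult_ac)
  finally have g1: "g1 = W * (c' * (g3 - d * c' * g2))"
    by (simp add: c')
  show "W ^ 2 dvd A \<and> W ^ 2 dvd B"
    unfolding A B by (subst g0, subst g1) (simp add: power2_eq_square flip: mult.assoc)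
next
  assume "W ^ 2 dvd A \<and> W ^ 2 dvd B"
  then obtain A' B' where "A = W ^ 2 * A'" "B = W ^ 2 * B'" by (auto simp: dvd_def)
  then have "uv_poly A B 0 0 = M * (uv_poly W 0 c d * uv_poly A' B' 0 0)"
    by (simp add: M uv_poly_mult uv_poly_eq_iff power2_eq_square algebra_simps)
  then show "M dvd uv_poly A B 0 0" by (rule dvdI)
qed

lemma normal_form: obtains A B where "pcong M f (uv_poly A B 0 0)"
proof -
  obtain f0 f1 f2 f3 where f: "f = uv_poly f0 f1 f2 f3" by (rule uv_poly_surj)
  define g0 where "g0 = - (c' * f2)"
  define g1 where "g1 = - (c' * (f3 + d * g0))"
  have "c * g0 = - f2" "c * g1 = - (f3 + d * g0)"
    unfolding g0_def g1_def by (simp_all add: c' flip: mult.assoc)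
  then have "f2 = - (c * g0)" "f3 = - (c * g1) - d * g0"
    by simp_all
  then have "f - uv_poly (f0 - W * g0) (f1 - W * g1) 0 0 = M * uv_poly g0 g1 0 0"
    by (simp add: f M uv_poly_mult uv_poly_diff uv_poly_eq_iff algebra_simps)
  then have "pcong M f (uv_poly (f0 - W * g0) (f1 - W * g1) 0 0)"
    by (simp add: pcong_def)
  then show ?thesis by (rule that)
qed

end

section \<open>The annihilator of a principal ideal\<close>

text \<open>Now \<open>W = w^N\<close>, so that \<open>A + u B\<close> vanishes iff \<open>w^(2N)\<close> divides \<open>A\<close> and \<open>B\<close>. The annihilator of
  \<open>G = w^l + u w^t Z\<close> is determined by solving \<open>(A + u B) G = 0\<close> in \<open>F[x]\<close>.\<close>

context
  fixes w c d c' Z :: "'a::field poly" and M G :: "'a uvring poly" and N l t :: nat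
  assumes M: "M = uv_poly (w ^ N) 0 (- c) (- d)" and c': "c * c' = 1" and w: "w \<noteq> 0"
    and G: "G = uv_poly (w ^ l) (w ^ t * Z) 0 0" and l: "l \<le> 2 * N" and t: "t \<le> l"
begin

lemma M_dvd_iff: "M dvd uv_poly A B 0 0 \<longleftrightarrow> w ^ (2 * N) dvd A \<and> w ^ (2 * N) dvd B"
  using modulus_dvd_iff[OF M c'] by (simp add: mult.commute flip: power_mult)

text \<open>The component of \<open>f\<close> without \<open>u\<close> is a multiple of \<open>w^(2N-l)\<close>, as \<open>w^(2N)\<close> divides its product
  with \<open>w^l\<close>. What remains is one equation that links it to the component \<open>B\<close> with \<open>u\<close>.\<close>

lemma annihilates_G:
  assumes "M dvd f * G"
  obtains A B D where "pcong M f (uv_poly (w ^ (2 * N - l) * A) B 0 0)"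
    "w ^ (2 * N - l + t) * (A * Z) + w ^ l * B = w ^ (2 * N) * D"
proof -
  obtain A B where f: "pcong M f (uv_poly A B 0 0)"
    using normal_form[OF M c'] .
  then have "M dvd uv_poly A B 0 0 * G"
    using assms pcong_dvd pcong_mult pcong_refl by metis
  then have *: "w ^ (2 * N) dvd A * w ^ l" "w ^ (2 * N) dvd A * (w ^ t * Z) + B * w ^ l"
    by (simp_all add: G uv_poly_mult M_dvd_iff)
  from *(1) have "w ^ (2 * N - l) * w ^ l dvd A * w ^ l"
    using l by (simp flip: power_add)
  then obtain A' where A: "A = w ^ (2 * N - l) * A'"
    using w by (auto simp: dvd_def)
  from *(2) obtain D where "A * (w ^ t * Z) + B * w ^ l = w ^ (2 * N) * D"
    by (auto simp: dvd_def)
  then have "w ^ (2 * N - l + t) * (A' * Z) + w ^ l * B = w ^ (2 * N) * D"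
    by (simp add: A power_add mult_ac)
  then show ?thesis using that f A by blast
qed

text \<open>Here \<open>l \<le> 2N - l + t\<close>, so the equation of the previous lemma can be divided by \<open>w^l\<close> and
  determines \<open>B\<close> up to a multiple of \<open>w^(2N-l)\<close>; such a multiple is produced by a
  summand of the cofactor \<open>h\<close> that is divisible by \<open>u\<close>. The same freedom allows replacing \<open>Z\<close> by its
  truncation \<open>Z1\<close> modulo \<open>w^(l-t)\<close>.\<close>

lemma annihilator_principal:
  assumes lt: "2 * l \<le> 2 * N + t" and Z: "Z = Z1 + w ^ (l - t) * Z2"
    and X: "X = uv_poly (w ^ (2 * N - l)) (- (w ^ (2 * N + t - 2 * l) * Z1)) 0 0"
  shows "M dvd X * G" and "M dvd f * G \<Longrightarrow> \<exists>h. pcong M f (h * X)"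
proof -
  have e1: "w ^ (2 * N - l) * w ^ l = w ^ (2 * N)"
    using l by (simp flip: power_add)
  have e2: "w ^ (2 * N - l) * w ^ t = w ^ (2 * N + t - 2 * l) * w ^ l"
    using l lt by (simp flip: power_add)
  have e3: "w ^ t * w ^ (l - t) = w ^ l"
    using t by (simp flip: power_add)
  have "w ^ (2 * N - l) * (w ^ t * Z) + - (w ^ (2 * N + t - 2 * l) * Z1) * w ^ l =
      (w ^ (2 * N - l) * w ^ t) * Z - (w ^ (2 * N + t - 2 * l) * w ^ l) * Z1"
    by (simp add: mult_ac)
  also have "\<dots> = w ^ (2 * N - l) * (w ^ t * w ^ (l - t)) * Z2"
    unfolding e2[symmetric] Z by (simp add: algebra_simps)
  also have "\<dots> = w ^ (2 * N) * Z2"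
    by (simp only: e3 e1)
  finally have u: "w ^ (2 * N - l) * (w ^ t * Z) + - (w ^ (2 * N + t - 2 * l) * Z1) * w ^ l =
    w ^ (2 * N) * Z2" .
  show "M dvd X * G"
    unfolding X G uv_poly_mult using u by (simp add: M_dvd_iff e1)
  show "\<exists>h. pcong M f (h * X)" if f: "M dvd f * G"
  proof -
    obtain A B D where fAB: "pcong M f (uv_poly (w ^ (2 * N - l) * A) B 0 0)"
      and D: "w ^ (2 * N - l + t) * (A * Z) + w ^ l * B = w ^ (2 * N) * D"
      using annihilates_G[OF f] .
    have "w ^ l * (w ^ (2 * N + t - 2 * l) * (A * Z) + B) =
        (w ^ (2 * N - l) * w ^ t) * (A * Z) + w ^ l * B"
      unfolding e2 by (simp only: distrib_left distrib_right mult_ac)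
    also have "\<dots> = w ^ (2 * N) * D"
      using D by (simp only: power_add)
    also have "\<dots> = w ^ l * (w ^ (2 * N - l) * D)"
      by (simp only: e1[symmetric] mult.left_commute[of "w ^ l"] mult.assoc)
    finally have "w ^ (2 * N + t - 2 * l) * (A * Z) + B = w ^ (2 * N - l) * D"
      using w by (metis mult_left_cancel power_not_zero)
    then have "B = w ^ (2 * N - l) * D - w ^ (2 * N + t - 2 * l) * (A * Z)"
      by (metis add_diff_cancel_left')
    moreover have e4: "w ^ (2 * N + t - 2 * l) * w ^ (l - t) = w ^ (2 * N - l)"
      using l lt t by (simp flip: power_add)
    have "w ^ (2 * N + t - 2 * l) * (A * Z) =
        w ^ (2 * N + t - 2 * l) * (A * Z1) + (w ^ (2 * N + t - 2 * l) * w ^ (l - t)) * (A * Z2)"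
      unfolding Z by (simp only: distrib_left distrib_right mult_ac)
    ultimately have "uv_poly (w ^ (2 * N - l) * A) B 0 0 = uv_poly A (D - A * Z2) 0 0 * X"
      unfolding e4 by (simp add: X uv_poly_mult uv_poly_eq_iff algebra_simps)
    with fAB show ?thesis by metis
  qed
qed

text \<open>Here \<open>2N - l + t < l\<close>. The equation for \<open>A\<close> and \<open>B\<close>, divided by \<open>w^(2N-l+t)\<close>, shows that
  \<open>w^e\<close> with \<open>e = 2l - 2N - t\<close> divides \<open>A Z\<close>, hence \<open>A\<close>, because \<open>Z\<close> is invertible modulo \<open>w^(2N)\<close>.
  Afterwards \<open>B\<close> is determined up to a multiple of \<open>w^(2N-l)\<close>. That multiple needs the second
  generator \<open>u w^(2N-l)\<close>, and it allows truncating \<open>Z\<close> modulo \<open>w^(2N-l)\<close>.\<close>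

lemma annihilator_two_generators:
  assumes lt: "2 * N + t < 2 * l" and Z: "Z = Z1 + w ^ (2 * N - l) * Z2"
    and Y: "w ^ (2 * N) dvd Z * Y - 1"
    and X: "X = uv_poly (w ^ (l - t)) (- Z1) 0 0"
    and X': "X' = uv_poly 0 (w ^ (2 * N - l)) 0 0"
  shows "M dvd X * G" and "M dvd X' * G"
    and "M dvd f * G \<Longrightarrow> \<exists>h k. pcong M f (h * X + k * X')"
proof -
  define e where "e = 2 * l - (2 * N + t)"
  have e1: "w ^ (2 * N - l) * w ^ l = w ^ (2 * N)"
    using l by (simp flip: power_add)
  have e2: "w ^ (l - t) * w ^ t = w ^ l"
    using t by (simp flip: power_add)
  have "w ^ (l - t) * (w ^ t * Z) + - Z1 * w ^ l = (w ^ (l - t) * w ^ t) * Z - w ^ l * Z1"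
    by (simp add: mult_ac)
  also have "\<dots> = w ^ (2 * N - l) * w ^ l * Z2"
    unfolding e2 Z by (simp add: algebra_simps)
  finally have u: "w ^ (l - t) * (w ^ t * Z) + - Z1 * w ^ l = w ^ (2 * N) * Z2"
    unfolding e1 .
  have "w ^ (l - t) * w ^ l = w ^ (2 * N) * w ^ e"
  proof -
    have "l - t + l = 2 * N + e" using lt t by (simp add: e_def)
    then show ?thesis by (metis power_add)
  qed
  then show "M dvd X * G"
    unfolding X G uv_poly_mult using u by (simp add: M_dvd_iff)
  show "M dvd X' * G"
    unfolding X' G uv_poly_mult by (simp add: M_dvd_iff e1)
  show "\<exists>h k. pcong M f (h * X + k * X')" if f: "M dvd f * G"
  proof -
    obtain A B D where fAB: "pcong M f (uv_poly (w ^ (2 * N - l) * A) B 0 0)"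
      and D: "w ^ (2 * N - l + t) * (A * Z) + w ^ l * B = w ^ (2 * N) * D"
      using annihilates_G[OF f] .
    let ?s = "w ^ (2 * N - l + t)"
    have p1: "w ^ l = ?s * w ^ e" and p2: "w ^ (2 * N) = ?s * (w ^ e * w ^ (2 * N - l))"
      using lt l t by (simp_all add: e_def flip: power_add)
    have "?s * (A * Z + w ^ e * B) = ?s * (w ^ e * w ^ (2 * N - l) * D)"
      using D unfolding p1 p2 by (simp only: distrib_left distrib_right mult_ac)
    then have AB: "A * Z + w ^ e * B = w ^ e * w ^ (2 * N - l) * D"
      using w by (metis mult_left_cancel power_not_zero)
    have "A * Z = w ^ e * w ^ (2 * N - l) * D - w ^ e * B"
      by (simp only: AB[symmetric] add_diff_cancel_right')
    then have "A * Z = w ^ e * (w ^ (2 * N - l) * D - B)"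
      by (simp only: right_diff_distrib mult.assoc)
    then have "w ^ e dvd A * Z" by (rule dvdI)
    then have "w ^ e dvd A * Z * Y" by (rule dvd_mult2)
    moreover have "w ^ e dvd w ^ (2 * N)"
      using lt l by (intro le_imp_power_dvd) (simp add: e_def)
    then have "w ^ e dvd A * (Z * Y - 1)"
      using Y by (intro dvd_mult) (rule dvd_trans)
    ultimately have "w ^ e dvd A * Z * Y - A * (Z * Y - 1)"
      by (rule dvd_diff)
    also have "A * Z * Y - A * (Z * Y - 1) = A"
      by (simp add: algebra_simps)
    finally obtain A' where A': "A = w ^ e * A'"
      by (rule dvdE)
    have "w ^ e * (A' * Z + B) = w ^ e * (w ^ (2 * N - l) * D)"
      using AB unfolding A' by (simp only: distrib_left distrib_right mult_ac)
    then have "A' * Z + B = w ^ (2 * N - l) * D"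
      using w by (metis mult_left_cancel power_not_zero)
    then have "B = w ^ (2 * N - l) * D - A' * Z"
      by (metis add_diff_cancel_left')
    then have B: "B = w ^ (2 * N - l) * (D - A' * Z2) - A' * Z1"
      unfolding Z by (simp add: algebra_simps)
    have "w ^ (2 * N - l) * A = w ^ (l - t) * A'"
      unfolding A' using lt l t by (simp add: e_def flip: power_add mult.assoc)
    then have "uv_poly (w ^ (2 * N - l) * A) B 0 0 =
        uv_poly A' 0 0 0 * X + uv_poly (D - A' * Z2) 0 0 0 * X'"
      by (simp add: X X' B uv_poly_mult uv_poly_add uv_poly_eq_iff algebra_simps)
    with fAB show ?thesis by metis
  qed
qed

end

section \<open>Powers in finite fields\<close>

text \<open>Translation by \<open>1\<close> permutes the field, so summing over all elements gives \<open>CARD('a) = 0\<close> in the field.\<close>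

lemma CHAR_eq_of_card:
  assumes p: "prime p" and card: "CARD('a::{field,finite}) = p ^ m"
  shows "CHAR('a) = p"
proof -
  have "(\<Sum>x\<in>UNIV. x + 1) = (\<Sum>x\<in>UNIV. x :: 'a)"
    by (rule sum.reindex_bij_witness[of _ "\<lambda>x. x - 1" "\<lambda>x. x + 1"]) auto
  then have "of_nat CARD('a) = (0 :: 'a)"
    by (simp add: sum.distrib)
  then have "of_nat p = (0 :: 'a)"
    by (simp add: card)
  then have "CHAR('a) dvd p"
    by (simp add: of_nat_eq_0_iff_char_dvd)
  moreover have "CHAR('a) \<noteq> 1" by simp
  ultimately show ?thesis
    using p prime_nat_iff by blast
qed

text \<open>Multiplication by \<open>x \<noteq> 0\<close> permutes the nonzero elements; compare the products over them.\<close>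

lemma power_card_eq_self:
  fixes x :: "'a::{field,finite}"
  shows "x ^ CARD('a) = x"
proof (cases "x = 0")
  case False
  let ?U = "UNIV - {0 :: 'a}"
  have "(\<Prod>y\<in>?U. x * y) = (\<Prod>y\<in>?U. y)"
    by (rule prod.reindex_bij_witness[of _ "\<lambda>y. y / x" "\<lambda>y. x * y"]) (use False in auto)
  then have "x ^ card ?U * \<Prod>?U = 1 * \<Prod>?U"
    by (simp only: prod.distrib prod_constant mult_1)
  moreover have "\<Prod>?U \<noteq> 0" by simp
  ultimately have "x ^ card ?U = 1"
    by (simp only: mult_cancel_right simp_thms)
  moreover have "CARD('a) = Suc (card ?U)"
    using card_Suc_Diff1[of UNIV "0 :: 'a"] by simp
  ultimately show ?thesis
    by (simp only: power_Suc mult_1_right)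
qed simp

lemma power_card_power_eq_self:
  fixes x :: "'a::{field,finite}"
  shows "x ^ (CARD('a) ^ k) = x"
  by (induction k) (simp_all add: power_card_eq_self power_mult)

lemma cubic_power:
  fixes a :: "'a::field"
  assumes "prime CHAR('a)" "N = CHAR('a) ^ s"
  shows "cubic a ^ N = monom 1 (3 * N) - [:a ^ N:]"
proof -
  have "monom 1 (3 * N) = (cubic a + [:a:]) ^ N"
    by (simp add: cubic_def monom_power)
  also have "\<dots> = cubic a ^ N + [:a:] ^ N"
    using assms by (intro freshmans_dream') simp_all
  finally show ?thesis
    by (simp add: poly_const_pow)
qed

lemma finite_UNIV_uvring: "finite (UNIV :: 'a::{comm_ring_1,finite} uvring set)"
proof -
  have "(UNIV :: 'a uvring set) = range (\<lambda>(a, b, c, d). UV a b c d)"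
    by (auto simp: image_iff) (metis uvring.exhaust)
  then show ?thesis by (metis finite finite_imageI)
qed

section \<open>Reciprocals of the generators\<close>

text \<open>\<open>g\<close> represents \<open>x^d f(1/x)\<close>. The number \<open>d\<close> is recorded because summands can only be combined
  after they have been brought to the same power of \<open>x\<close>.\<close>

definition reverses :: "nat \<Rightarrow> 'a::comm_ring_1 uvring \<Rightarrow> 'a uvring \<Rightarrow> nat \<Rightarrow> 'a poly \<Rightarrow> 'a poly \<Rightarrow> bool" where
  "reverses n a b d f g \<longleftrightarrow>
     pcong (consta_poly n b) (emb_poly g) (monom 1 d * invert_var n a (emb_poly f))"

context
  fixes n :: nat and a b :: "'a::field uvring"
  assumes n: "n \<ge> 1" and ab: "a * b = 1"
begin

lemma reverses_mult:
  assumes "reverses n a b d f g" "reverses n a b d' f' g'"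
  shows "reverses n a b (d + d') (f * f') (g * g')"
proof -
  have "pcong (consta_poly n b) (emb_poly g * emb_poly g')
      ((monom 1 d * invert_var n a (emb_poly f)) * (monom 1 d' * invert_var n a (emb_poly f')))"
    using assms unfolding reverses_def by (rule pcong_mult)
  also have "\<dots> = (monom 1 d * monom 1 d') * (invert_var n a (emb_poly f) * invert_var n a (emb_poly f'))"
    by (simp only: mult_ac)
  finally show ?thesis
    by (simp add: reverses_def emb_poly_mult invert_var_def pcompose_mult mult_monom)
qed

lemma reverses_1: "reverses n a b 0 1 1"
  by (simp add: reverses_def invert_var_def pcompose_1)

lemma reverses_power:
  assumes "reverses n a b d f g"
  shows "reverses n a b (d * k) (f ^ k) (g ^ k)"
proof (induction k)
  case (Suc k)
  then show ?case
    using reverses_mult[OF assms Suc] by simp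
qed (simp add: reverses_1)

lemma reverses_shift:
  assumes "reverses n a b d f g"
  shows "reverses n a b (d + r) f (g * monom 1 r)"
proof -
  have "pcong (consta_poly n b) (emb_poly g * monom 1 r)
      ((monom 1 d * invert_var n a (emb_poly f)) * monom 1 r)"
    using assms unfolding reverses_def by (intro pcong_mult pcong_refl)
  also have "\<dots> = monom 1 d * monom 1 r * invert_var n a (emb_poly f)"
    by (simp only: mult_ac)
  finally show ?thesis
    by (simp add: reverses_def emb_poly_mult map_poly_monom mult_monom)
qed

lemma reverses_sum:
  assumes "\<And>i. i \<in> I \<Longrightarrow> reverses n a b d (f i) (g i)"
  shows "reverses n a b d (sum f I) (sum g I)"
  using pcong_sum[of I "consta_poly n b" "\<lambda>i. emb_poly (g i)" "\<lambda>i. monom 1 d * invert_var n a (emb_poly (f i))"] assms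
  by (simp add: reverses_def emb_poly_sum invert_var_def pcompose_sum sum_distrib_left)

lemma reverses_reversal:
  assumes "degree f \<le> d"
  shows "reverses n a b d f (\<Sum>i\<le>d. monom (coeff f i) (d - i))"
proof -
  have "degree (emb_poly f) \<le> d"
    using assms map_poly_degree_leq by (rule order_trans[rotated])
  from reversal_cong[OF n ab this] show ?thesis
    by (simp add: reverses_def emb_poly_sum map_poly_monom coeff_map_poly)
qed

lemma reverses_quadratic: "reverses n a b 2 [:x, y, z:] [:z, y, x:]"
proof -
  have "degree [:x, y, z:] \<le> 2" by simp
  from reverses_reversal[OF this] show ?thesis
    by (simp add: eval_nat_numeral atMost_Suc monom_Suc monom_0)
qed

text \<open>\<open>x^3 (1/x^3 - c) = 1 - c x^3 = - c (x^3 - 1/c)\<close>: the source of the powers of \<open>- c\<close> in the generators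
  of the dual code.\<close>

lemma reverses_cubic:
  assumes "c \<noteq> 0"
  shows "reverses n a b 3 (cubic c) (smult (- c) (cubic (inverse c)))"
proof -
  have "degree (cubic c) \<le> 3"
    unfolding cubic_def by (intro degree_diff_le) (simp_all add: degree_monom_le)
  from reverses_reversal[OF this]
  have "reverses n a b 3 (cubic c) (\<Sum>i\<le>3. monom (coeff (cubic c) i) (3 - i))" .
  also have "(\<Sum>i\<le>3. monom (coeff (cubic c) i) (3 - i)) = smult (- c) (cubic (inverse c))"
    using assms by (simp add: eval_nat_numeral atMost_Suc cubic_def monom_Suc monom_0)
  finally show ?thesis .
qed

lemma reverses_cubic_power:
  assumes "c \<noteq> 0"
  shows "reverses n a b (3 * k) (cubic c ^ k) (smult ((- c) ^ k) (cubic (inverse c) ^ k))"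
  using reverses_power[OF reverses_cubic[OF assms], of k] by (simp only: smult_power)

text \<open>The summand with index \<open>k\<close> is naturally reversed with \<open>x^(3k+2)\<close>; the last monomial lifts it to the
  common exponent \<open>3r\<close>, whence the bound on \<open>k\<close>.\<close>

lemma reverses_truncated_sum:
  assumes c: "c \<noteq> 0" and r: "\<And>k. k \<in> I \<Longrightarrow> 3 * k + 2 \<le> 3 * r"
  shows "reverses n a b (3 * r) (\<Sum>k\<in>I. [:z2 k, z1 k, z0 k:] * cubic c ^ k)
    (\<Sum>k\<in>I. [:z0 k, z1 k, z2 k:] * smult ((- c) ^ k) (cubic (inverse c) ^ k)
       * monom 1 (3 * r - 3 * k - 2))"
proof (rule reverses_sum)
  fix k assume "k \<in> I"
  then have "(2 + 3 * k) + (3 * r - 3 * k - 2) = 3 * r"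
    using r[of k] by simp
  then show "reverses n a b (3 * r) ([:z2 k, z1 k, z0 k:] * cubic c ^ k)
     ([:z0 k, z1 k, z2 k:] * smult ((- c) ^ k) (cubic (inverse c) ^ k) * monom 1 (3 * r - 3 * k - 2))"
    using reverses_shift[OF reverses_mult[OF reverses_quadratic reverses_cubic_power[OF c]]]
    by metis
qed

lemma reverses_passoc:
  assumes "reverses n a b d f g" "reverses n a b d f' g'"
  shows "passoc (consta_poly n b) (emb_poly g - smult uu (emb_poly g'))
    (invert_var n a (emb_poly f - smult uu (emb_poly f')))"
proof (rule passocI)
  show "pcong (consta_poly n b) (monom 1 d * monom a (n - 1) ^ d) 1"
    by (rule x_power_times_inverse[OF n ab])
  have "pcong (consta_poly n b) (emb_poly g - smult uu (emb_poly g'))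
      (monom 1 d * invert_var n a (emb_poly f) - smult uu (monom 1 d * invert_var n a (emb_poly f')))"
    using assms unfolding reverses_def by (intro pcong_diff pcong_smult)
  then show "pcong (consta_poly n b) (emb_poly g - smult uu (emb_poly g'))
      (monom 1 d * invert_var n a (emb_poly f - smult uu (emb_poly f')))"
    by (simp add: invert_var_def pcompose_diff pcompose_smult right_diff_distrib)
qed

text \<open>The two parts of the generator are reversed with the same power of \<open>x\<close>, as
  \<open>3 (2N + t - 2l) + 3 (l - t) = 3 (2N - l)\<close> for \<open>N = p^s\<close>.\<close>

lemma chi1_star_passoc:
  assumes c: "c \<noteq> 0" and t: "t < l" and l: "2 * l \<le> 2 * p ^ s + t"
  shows "passoc (consta_poly n b) (chi1_star p s l t c z0 z1 z2)
    (invert_var n a (emb_poly (cubic c ^ (2 * p ^ s - l)) -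
       smult uu (emb_poly (cubic c ^ (2 * p ^ s + t - 2 * l) *
         (\<Sum>k=0..l - t - 1. [:z2 k, z1 k, z0 k:] * cubic c ^ k)))))"
proof -
  let ?N = "p ^ s"
  have "reverses n a b (3 * (2 * ?N + t - 2 * l) + 3 * (l - t))
    (cubic c ^ (2 * ?N + t - 2 * l) * (\<Sum>k=0..l - t - 1. [:z2 k, z1 k, z0 k:] * cubic c ^ k))
    (smult ((- c) ^ (2 * ?N + t - 2 * l)) (cubic (inverse c) ^ (2 * ?N + t - 2 * l)) *
     (\<Sum>k=0..l - t - 1. [:z0 k, z1 k, z2 k:] * smult ((- c) ^ k) (cubic (inverse c) ^ k)
       * monom 1 (3 * (l - t) - 3 * k - 2)))"
    using t by (intro reverses_mult reverses_cubic_power reverses_truncated_sum c) auto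
  moreover have "3 * (2 * ?N + t - 2 * l) + 3 * (l - t) = 3 * (2 * ?N - l)"
    using t l by simp
  moreover have "3 * (l - t) = 3 * l - 3 * t" by simp
  ultimately show ?thesis
    unfolding chi1_star_def using reverses_cubic_power[OF c, of "2 * ?N - l"]
    by (intro reverses_passoc) simp_all
qed

lemma chi2_star_passoc:
  assumes c: "c \<noteq> 0" and t: "t < l" and l: "2 * p ^ s + t < 2 * l" and l2: "l < 2 * p ^ s"
  shows "passoc (consta_poly n b) (chi2_star p s l t c z0 z1 z2)
    (invert_var n a (emb_poly (cubic c ^ (l - t)) -
       smult uu (emb_poly (\<Sum>k=0..2 * p ^ s - l - 1. [:z2 k, z1 k, z0 k:] * cubic c ^ k))))"
proof -
  let ?N = "p ^ s"
  have "reverses n a b (3 * (l - t))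
    (\<Sum>k=0..2 * ?N - l - 1. [:z2 k, z1 k, z0 k:] * cubic c ^ k)
    (\<Sum>k=0..2 * ?N - l - 1. [:z0 k, z1 k, z2 k:] * smult ((- c) ^ k) (cubic (inverse c) ^ k)
       * monom 1 (3 * (l - t) - 3 * k - 2))"
    using t l l2 by (intro reverses_truncated_sum c) auto
  moreover have "3 * (l - t) = 3 * l - 3 * t" by simp
  ultimately show ?thesis
    unfolding chi2_star_def using reverses_cubic_power[OF c, of "l - t"]
    by (intro reverses_passoc) simp_all
qed

text \<open>The unit scalar \<open>(- c)^k\<close> is dropped here, which changes the generator but not the ideal.\<close>

lemma cubic_power_passoc:
  assumes c: "c \<noteq> 0"
  shows "passoc (consta_poly n b) (emb_poly (cubic (inverse c) ^ k)) (invert_var n a (emb_poly (cubic c ^ k)))"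
proof (rule passocI)
  let ?e = "emb ((- c) ^ k)" and ?e' = "emb (inverse ((- c) ^ k))"
  have e: "?e' * ?e = 1" using c by (simp flip: emb_mult)
  have "smult ?e' (monom 1 (3 * k)) * smult ?e (monom a (n - 1) ^ (3 * k)) =
      smult (?e' * ?e) (monom 1 (3 * k) * monom a (n - 1) ^ (3 * k))"
    by (simp add: mult.commute)
  then show "pcong (consta_poly n b) (smult ?e' (monom 1 (3 * k)) * smult ?e (monom a (n - 1) ^ (3 * k))) 1"
    using x_power_times_inverse[OF n ab] e by simp
  have smult: "emb_poly (smult x f) = smult (emb x) (emb_poly f)" for x :: 'a and f
    by (simp add: map_poly_smult emb_mult)
  have "pcong (consta_poly n b) (smult ?e' (emb_poly (smult ((- c) ^ k) (cubic (inverse c) ^ k))))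
      (smult ?e' (monom 1 (3 * k) * invert_var n a (emb_poly (cubic c ^ k))))"
    using reverses_cubic_power[OF c, of k] unfolding reverses_def by (rule pcong_smult)
  then show "pcong (consta_poly n b) (emb_poly (cubic (inverse c) ^ k))
      (smult ?e' (monom 1 (3 * k)) * invert_var n a (emb_poly (cubic c ^ k)))"
    using e by (simp add: smult)
qed

lemma passoc_smult_invert:
  assumes "passoc (consta_poly n b) g (invert_var n a f)"
  shows "passoc (consta_poly n b) (smult u g) (invert_var n a (smult u f))"
proof -
  obtain e e' where e: "pcong (consta_poly n b) (e * e') 1" "pcong (consta_poly n b) g (e * invert_var n a f)"
    using assms by (auto simp: passoc_def)
  have "pcong (consta_poly n b) (smult u g) (smult u (e * invert_var n a f))"
    using e(2) by (rule pcong_smult)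
  then show ?thesis
    using e(1) by (intro passocI[of _ e e']) (simp_all add: invert_var_def pcompose_smult)
qed

end

section \<open>The dual code\<close>

lemma annihilator_gen_ideal_eqI:
  assumes "\<And>g. g \<in> S \<Longrightarrow> consta_poly n a dvd g * G"
    and "\<And>f. consta_poly n a dvd f * G \<Longrightarrow> residue_class n a f \<in> gen_ideal n a S"
  shows "annihilator (consta_ring n a) (gen_ideal n a {G}) = gen_ideal n a S"
proof
  show "gen_ideal n a S \<subseteq> annihilator (consta_ring n a) (gen_ideal n a {G})"
    by (rule gen_ideal_minimal[OF ideal_annihilator[OF ideal_subset_carrier[OF ideal_gen_ideal]]])
      (simp add: annihilator_gen_ideal_iff assms(1))
  show "annihilator (consta_ring n a) (gen_ideal n a {G}) \<subseteq> gen_ideal n a S"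
    by (rule subset_residueI
          [OF ideal_subset_carrier[OF ideal_annihilator[OF ideal_subset_carrier[OF ideal_gen_ideal]]]])
      (simp add: annihilator_gen_ideal_iff assms(2))
qed

lemma truncate_sum:
  fixes q :: "nat \<Rightarrow> 'a::comm_ring_1"
  assumes "\<And>k. k \<ge> K \<Longrightarrow> q k = 0" and r: "r \<ge> 1"
  obtains y where "(\<Sum>k<K. q k * w ^ k) = (\<Sum>k=0..r - 1. q k * w ^ k) + w ^ r * y"
proof
  let ?y = "\<Sum>k\<in>{r..<max K r}. q k * w ^ (k - r)"
  have "(\<Sum>k<K. q k * w ^ k) = (\<Sum>k<max K r. q k * w ^ k)"
    using assms(1) by (intro sum.mono_neutral_left) auto
  also have "{..<max K r} = {0..r - 1} \<union> {r..<max K r}"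
    using r by auto
  also have "(\<Sum>k\<in>\<dots>. q k * w ^ k) = (\<Sum>k=0..r - 1. q k * w ^ k) + (\<Sum>k\<in>{r..<max K r}. q k * w ^ k)"
    using r by (intro sum.union_disjoint) auto
  also have "(\<Sum>k\<in>{r..<max K r}. q k * w ^ k) = w ^ r * ?y"
    unfolding sum_distrib_left
    by (intro sum.cong refl) (simp add: mult.left_commute flip: power_add)
  finally show "(\<Sum>k<K. q k * w ^ k) = (\<Sum>k=0..r - 1. q k * w ^ k) + w ^ r * ?y" .
qed

theorem theorem4p5:
  fixes p m s q0 r0 l t n K :: nat
    and \<alpha>\<^sub>0 \<alpha>\<^sub>1 \<alpha>\<^sub>3 \<alpha>\<^sub>4 :: "'a::{field,finite}"
    and z0 z1 z2 :: "nat \<Rightarrow> 'a"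
    and \<alpha> \<beta> :: "'a uvring"
    and z :: "'a uvring poly"
    and C A_star :: "'a uvring poly set set"
  assumes "prime p" "p \<noteq> 3" "m \<ge> 1" "s \<ge> 1"
    and "CARD('a) = p ^ m"
    and "s = q0 * m + r0" "r0 \<le> m - 1"
    and "\<alpha>\<^sub>1 \<noteq> 0" "\<alpha>\<^sub>3 \<noteq> 0" "\<alpha>\<^sub>4 \<noteq> 0"
    and "\<alpha>\<^sub>0 = \<alpha>\<^sub>1 ^ (p ^ (m - r0))"
    and "\<alpha> = emb \<alpha>\<^sub>1 + emb \<alpha>\<^sub>3 * vv + emb \<alpha>\<^sub>4 * uu * vv"
    and "\<not> (\<exists>\<gamma>. \<alpha> = \<gamma> ^ 3)"
    and "\<beta> = inv\<^bsub>type_ring\<^esub> \<alpha>"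
    and "n = 3 * p ^ s"
    and "1 \<le> l" "l \<le> 2 * p ^ s - 1" "t < l"
    and "residue_class n \<alpha> z = \<zero>\<^bsub>consta_ring n \<alpha>\<^esub> \<or>
         residue_class n \<alpha> z \<in> Units (consta_ring n \<alpha>)"
    and "residue_class n \<alpha> z \<in> Units (consta_ring n \<alpha>) \<Longrightarrow>
           (\<forall>k\<ge>K. z0 k = 0 \<and> z1 k = 0 \<and> z2 k = 0) \<and>
           [:z2 0, z1 0, z0 0:] \<noteq> 0 \<and>
           residue_class n \<alpha> z = residue_class n \<alpha>
             (emb_poly (\<Sum>k<K. [:z2 k, z1 k, z0 k:] * cubic \<alpha>\<^sub>0 ^ k))"
    and "C = gen_ideal n \<alpha>
               {emb_poly (cubic \<alpha>\<^sub>0 ^ l) + smult uu (emb_poly (cubic \<alpha>\<^sub>0 ^ t) * z)}"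
    and "A_star = reciprocal_set n \<alpha> \<beta> (annihilator (consta_ring n \<alpha>) C)"
  shows "ideal A_star (consta_ring n \<beta>) \<and>
    words_of n \<beta> A_star = dual_code n (words_of n \<alpha> C) \<and>
    (residue_class n \<alpha> z = \<zero>\<^bsub>consta_ring n \<alpha>\<^esub> \<and> l \<le> p ^ s \<longrightarrow>
       A_star = gen_ideal n \<beta> {emb_poly (cubic (inverse \<alpha>\<^sub>0) ^ (2 * p ^ s - l))}) \<and>
    (residue_class n \<alpha> z \<in> Units (consta_ring n \<alpha>) \<and> real l \<le> real (p ^ s) + real t / 2 \<longrightarrow>
       A_star = gen_ideal n \<beta> {chi1_star p s l t \<alpha>\<^sub>0 z0 z1 z2}) \<and>
    (residue_class n \<alpha> z \<in> Units (consta_ring n \<alpha>) \<and> real (p ^ s) + real t / 2 < real l \<longrightarrow>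
       A_star = gen_ideal n \<beta>
         {chi2_star p s l t \<alpha>\<^sub>0 z0 z1 z2,
          smult uu (emb_poly (cubic (inverse \<alpha>\<^sub>0) ^ (2 * p ^ s - l)))})"
proof -
  let ?N = "p ^ s" and ?w = "cubic \<alpha>\<^sub>0"
  let ?M = "consta_poly n \<alpha>" and ?A = "annihilator (consta_ring n \<alpha>) C"
  let ?Z = "\<Sum>k<K. [:z2 k, z1 k, z0 k:] * ?w ^ k"

  have char: "CHAR('a) = p"
    using assms(1,5) by (rule CHAR_eq_of_card)
  \<comment> \<open>\<open>\<alpha>\<^sub>0\<close> is the \<open>p^s\<close>-th root of \<open>\<alpha>\<^sub>1\<close>: \<open>p^(m-r0+s)\<close> is a power of the field size.\<close>
  have "m - r0 + s = m * (q0 + 1)"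
    using assms(3,6,7) by (simp add: algebra_simps)
  then have "\<alpha>\<^sub>0 ^ ?N = \<alpha>\<^sub>1 ^ (CARD('a) ^ (q0 + 1))"
    unfolding assms(5,11) by (metis power_add power_mult)
  then have \<alpha>0_N: "\<alpha>\<^sub>0 ^ ?N = \<alpha>\<^sub>1"
    by (simp only: power_card_power_eq_self)
  have \<alpha>0: "\<alpha>\<^sub>0 \<noteq> 0"
    using assms(8,11) by simp
  have \<alpha>_UV: "\<alpha> = UV \<alpha>\<^sub>1 0 \<alpha>\<^sub>3 \<alpha>\<^sub>4"
    by (simp add: assms(12) emb_def uu_def vv_def)

  have n: "n \<ge> 1"
    using assms(1,15) by (simp add: prime_gt_0_nat Suc_le_eq)
  have wN: "?w ^ ?N = monom 1 n - [:\<alpha>\<^sub>1:]"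
    using cubic_power[of ?N s \<alpha>\<^sub>0] assms(1,15) by (simp add: char \<alpha>0_N)
  have M: "?M = uv_poly (?w ^ ?N) 0 (- [:\<alpha>\<^sub>3:]) (- [:\<alpha>\<^sub>4:])"
    by (rule poly_eqI)
      (simp add: wN consta_poly_def coeff_uv_poly \<alpha>_UV zero_uvring_def one_uvring_def coeff_pCons split: nat.split)
  have c': "[:\<alpha>\<^sub>3:] * [:inverse \<alpha>\<^sub>3:] = 1"
    using assms(9) by (simp add: one_pCons)
  have w0: "?w \<noteq> 0"
  proof
    assume "?w = 0"
    then have "coeff ?w 3 = 0" by simp
    then show False by (simp add: cubic_def eval_nat_numeral)
  qed
  have l2: "l < 2 * ?N"
    using assms(16,17) by linarith

  have \<alpha>_unit: "\<alpha> * \<beta> = 1"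
  proof -
    interpret R: cring "type_ring :: 'a uvring ring" by (rule cring_type_ring)
    \<comment> \<open>\<open>1 / (\<alpha>\<^sub>1 + y) = 1/\<alpha>\<^sub>1 - y/\<alpha>\<^sub>1^2\<close> for \<open>y = \<alpha>\<^sub>3 v + \<alpha>\<^sub>4 uv\<close>, because \<open>y^2 = 0\<close>.\<close>
    let ?i = "UV (inverse \<alpha>\<^sub>1) 0 (- \<alpha>\<^sub>3 * inverse \<alpha>\<^sub>1 ^ 2) (- \<alpha>\<^sub>4 * inverse \<alpha>\<^sub>1 ^ 2)"
    have "\<alpha> * ?i = 1"
      using assms(8) by (simp add: \<alpha>_UV one_uvring_def power2_eq_square)
    then have "\<alpha> \<in> Units (type_ring :: 'a uvring ring)"
      by (auto simp: Units_def type_ring_def mult.commute)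
    from R.Units_r_inv[OF this] show ?thesis
      by (simp add: assms(14) type_ring_def)
  qed
  note fin = finite_UNIV_uvring[where 'a = 'a]

  let ?G = "\<lambda>y. uv_poly (?w ^ l) (?w ^ t * y) 0 0"
  have C: "C = gen_ideal n \<alpha> {?G y}" if y: "pcong ?M z (emb_poly y)" for y
  proof -
    let ?g = "emb_poly (?w ^ l) + smult uu (emb_poly (?w ^ t) * z)"
    have "pcong ?M ?g (emb_poly (?w ^ l) + smult uu (emb_poly (?w ^ t) * emb_poly y))"
      by (intro pcong_add pcong_refl pcong_smult pcong_mult y)
    also have "emb_poly (?w ^ l) + smult uu (emb_poly (?w ^ t) * emb_poly y) = ?G y"
      by (simp only: emb_poly_mult[symmetric] smult_uu_emb_poly_eq_uv_poly
          emb_poly_eq_uv_poly[of "?w ^ l"] uv_poly_add) simp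
    finally have "residue_class n \<alpha> ?g = residue_class n \<alpha> (?G y)"
      by (simp add: residue_eq_iff)
    then show ?thesis
      by (simp add: assms(21) gen_ideal_def)
  qed
  note ann = M c' w0 refl less_imp_le[OF l2] less_imp_le[OF assms(18)]

  have C_ideal: "ideal C (consta_ring n \<alpha>)"
    unfolding assms(21) by (rule ideal_gen_ideal)
  have A_star_ideal: "ideal A_star (consta_ring n \<beta>)"
    unfolding assms(22) using C_ideal
    by (intro ideal_reciprocal_set n \<alpha>_unit fin ideal_annihilator ideal_subset_carrier)
  have dual: "words_of n \<beta> A_star = dual_code n (words_of n \<alpha> C)"
    unfolding assms(22)
    by (rule dual_code_eq_reciprocal_annihilator[OF n \<alpha>_unit fin C_ideal])

  have principal: "?A = gen_ideal n \<alpha> {emb_poly (?w ^ (2 * ?N - l)) -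
        smult uu (emb_poly (?w ^ (2 * ?N + t - 2 * l) * z1))}"
    if lt: "2 * l \<le> 2 * ?N + t" and y: "pcong ?M z (emb_poly y)"
      and z: "y = z1 + ?w ^ (l - t) * z2" for y z1 z2
  proof -
    let ?X = "emb_poly (?w ^ (2 * ?N - l)) - smult uu (emb_poly (?w ^ (2 * ?N + t - 2 * l) * z1))"
    have X: "?X = uv_poly (?w ^ (2 * ?N - l)) (- (?w ^ (2 * ?N + t - 2 * l) * z1)) 0 0"
      by (simp only: smult_uu_emb_poly_eq_uv_poly emb_poly_eq_uv_poly[of "?w ^ (2 * ?N - l)"] uv_poly_diff) simp
    note P = annihilator_principal[OF ann lt z X]
    show ?thesis
      unfolding C[OF y]
    proof (rule annihilator_gen_ideal_eqI)
      fix f assume "?M dvd f * ?G y"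
      then obtain h where "pcong ?M f (h * ?X)"
        using P(2) by blast
      then show "residue_class n \<alpha> f \<in> gen_ideal n \<alpha> {?X}"
        using ideal_residue_mult[OF ideal_gen_ideal gen_ideal_generator[of ?X "{?X}"], of n \<alpha> h]
        by (simp add: residue_eq_iff[symmetric])
    qed (use P(1) in simp)
  qed

  have zero: "A_star = gen_ideal n \<beta> {emb_poly (cubic (inverse \<alpha>\<^sub>0) ^ (2 * ?N - l))}"
    if z: "residue_class n \<alpha> z = \<zero>\<^bsub>consta_ring n \<alpha>\<^esub>" and l: "l \<le> ?N"
  proof -
    have "pcong ?M z (emb_poly 0)"
      using z by (simp add: residue_class_eq_zero_iff pcong_0_iff)
    \<comment> \<open>For \<open>z = 0\<close> the one-generator case applies with \<open>Z = 0\<close>.\<close>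
    moreover have "2 * l \<le> 2 * ?N + t" using l by simp
    ultimately have "?A = gen_ideal n \<alpha> {emb_poly (?w ^ (2 * ?N - l))}"
      using principal[of 0 0 0] by simp
    then show ?thesis
      unfolding assms(22) using cubic_power_passoc[OF n \<alpha>_unit \<alpha>0, of "2 * ?N - l"]
      by (simp only:) (rule reciprocal_set_gen_ideal[OF n \<alpha>_unit fin]; blast)
  qed

  have unit_z: "pcong ?M z (emb_poly ?Z)" "\<And>k. k \<ge> K \<Longrightarrow> [:z2 k, z1 k, z0 k:] = 0"
    if "residue_class n \<alpha> z \<in> Units (consta_ring n \<alpha>)"
    using assms(20)[OF that] by (simp_all add: residue_eq_iff)

  have unit1: "A_star = gen_ideal n \<beta> {chi1_star p s l t \<alpha>\<^sub>0 z0 z1 z2}"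
    if unit: "residue_class n \<alpha> z \<in> Units (consta_ring n \<alpha>)" and l: "2 * l \<le> 2 * ?N + t"
  proof -
    obtain y where y: "?Z = (\<Sum>k=0..l - t - 1. [:z2 k, z1 k, z0 k:] * ?w ^ k) + ?w ^ (l - t) * y"
      by (rule truncate_sum[of K "\<lambda>k. [:z2 k, z1 k, z0 k:]" "l - t" ?w])
        (use unit_z(2)[OF unit] assms(18) in auto)
    from principal[OF l unit_z(1)[OF unit] y] show ?thesis
      unfolding assms(22)
      using chi1_star_passoc[OF n \<alpha>_unit \<alpha>0 assms(18) l]
      by (simp only:) (rule reciprocal_set_gen_ideal[OF n \<alpha>_unit fin]; blast)
  qed

  have unit2: "A_star = gen_ideal n \<beta> {chi2_star p s l t \<alpha>\<^sub>0 z0 z1 z2,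
      smult uu (emb_poly (cubic (inverse \<alpha>\<^sub>0) ^ (2 * ?N - l)))}"
    if unit: "residue_class n \<alpha> z \<in> Units (consta_ring n \<alpha>)" and l: "2 * ?N + t < 2 * l"
  proof -
    define z1' where "z1' = (\<Sum>k=0..2 * ?N - l - 1. [:z2 k, z1 k, z0 k:] * ?w ^ k)"
    obtain y where z1': "?Z = z1' + ?w ^ (2 * ?N - l) * y"
      unfolding z1'_def
      by (rule truncate_sum[of K "\<lambda>k. [:z2 k, z1 k, z0 k:]" "2 * ?N - l" ?w])
        (use unit_z(2)[OF unit] l2 in auto)
    obtain g where "pcong ?M (z * g) 1"
      using unit by (rule residue_class_unitD)
    \<comment> \<open>The part without \<open>u\<close> of an inverse of \<open>z\<close> is an inverse in \<open>F[x]\<close> modulo \<open>w^(2N)\<close>.\<close>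
    moreover obtain A B where "pcong ?M g (uv_poly A B 0 0)"
      by (rule normal_form[OF M c'])
    ultimately have "pcong ?M (emb_poly ?Z * uv_poly A B 0 0) 1"
      using unit_z(1)[OF unit] pcong_mult pcong_sym pcong_trans by meson
    then have "?M dvd uv_poly (?Z * A - 1) (?Z * B) 0 0"
      by (simp add: pcong_def emb_poly_eq_uv_poly uv_poly_mult uv_poly_diff flip: uv_poly_1)
    then have inv: "?w ^ (2 * ?N) dvd ?Z * A - 1"
      using M_dvd_iff[OF ann(1-3)] by blast
    let ?X = "emb_poly (?w ^ (l - t)) - smult uu (emb_poly z1')"
    let ?X' = "smult uu (emb_poly (?w ^ (2 * ?N - l)))"
    have X: "?X = uv_poly (?w ^ (l - t)) (- z1') 0 0"
      by (simp only: smult_uu_emb_poly_eq_uv_poly emb_poly_eq_uv_poly[of "?w ^ (l - t)"] uv_poly_diff) simp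
    have X': "?X' = uv_poly 0 (?w ^ (2 * ?N - l)) 0 0"
      by (rule smult_uu_emb_poly_eq_uv_poly)
    note P = annihilator_two_generators[OF ann l z1' inv X X']
    have "?A = gen_ideal n \<alpha> {?X, ?X'}"
      unfolding C[OF unit_z(1)[OF unit]]
    proof (rule annihilator_gen_ideal_eqI)
      fix f assume "?M dvd f * ?G ?Z"
      then obtain h k where f: "pcong ?M f (h * ?X + k * ?X')"
        using P(3) by blast
      have "residue_class n \<alpha> (h * ?X + k * ?X') \<in> gen_ideal n \<alpha> {?X, ?X'}"
        by (intro ideal_residue_add ideal_residue_mult ideal_gen_ideal gen_ideal_generator) simp_all
      then show "residue_class n \<alpha> f \<in> gen_ideal n \<alpha> {?X, ?X'}"
        using f by (simp only: residue_eq_iff[symmetric])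
    qed (use P(1,2) in blast)
    moreover have "passoc (consta_poly n \<beta>) (chi2_star p s l t \<alpha>\<^sub>0 z0 z1 z2) (invert_var n \<alpha> ?X)"
      unfolding z1'_def by (rule chi2_star_passoc[OF n \<alpha>_unit \<alpha>0 assms(18) l l2])
    moreover have "passoc (consta_poly n \<beta>) (smult uu (emb_poly (cubic (inverse \<alpha>\<^sub>0) ^ (2 * ?N - l))))
        (invert_var n \<alpha> ?X')"
      by (intro passoc_smult_invert cubic_power_passoc n \<alpha>_unit \<alpha>0)
    ultimately show ?thesis
      unfolding assms(22) by (simp only:) (rule reciprocal_set_gen_ideal[OF n \<alpha>_unit fin]; blast)
  qed

  have "real l \<le> real ?N + real t / 2 \<longleftrightarrow> 2 * l \<le> 2 * ?N + t"
    by linarith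
  moreover have "real ?N + real t / 2 < real l \<longleftrightarrow> 2 * ?N + t < 2 * l"
    by linarith
  ultimately show ?thesis
    using A_star_ideal dual zero unit1 unit2 by blast
qed

end
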